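(* $\mathrm{LOP} \notin \mathsf{sAvoid}^{dt}$; that is, the Linear Ordering Principle does not admit an efficient (complexity $\mathrm{polylog}$ in the input length) decision-tree reduction (formulation) to Strong Avoid.
   Context: A query search problem is a sequence $R=(R_n)$ of relations $R_n\subseteq\{0,1\}^n\times\mathcal{O}_n$; it is total if every $x\in\{0,1\}^n$ has some $o$ with $(x,o)\in R_n$. $R$ belongs to $\mathrm{TF}\Sigma_2^{dt}$ if it is total and for every $n$ and $o\in\mathcal{O}_n$ there are decision trees $V_{o,z}$ of depth $\mathrm{polylog}(n)$, one for each string $z$ of length $\ell=\mathrm{polylog}(n)$, such that $R_n(x,o)$ holds iff $V_{o,z}(x)=1$ for all such $z$. For total search problems $R\subseteq\{0,1\}^n\times\mathcal{O}_n$ and $S\subseteq\{0,1\}^m\times\mathcal{O}'_m$, an $S$-formulation of $R$ consists of functions $f_i:\{0,1\}^n\to\{0,1\}$ ($i\in[m]$) and $g_o:\{0,1\}^n\to\mathcal{O}_n$ ($o\in\mathcal{O}'_m$) such that $S(f(x),o)\Rightarrow R(x,g_o(x))$ where $f(x)=(f_1(x),\dots,f_m(x))$. Its depth $d$ is the maximum decision-tree depth of the $f_i$ and $g_o$, its size is $m$, and its complexity is $\log m+d$. For sequences $R=(R_n)$, $S=(S_m)$, the complexity of reducing $R_n$ to $S$ is the minimum over $m$ and over $S_m$-formulations of $R_n$ of the complexity; $R\le_{dt}S$ if this is $\mathrm{polylog}(n)$. Strong Avoid ($\mathrm{sAvoid}$): the input is a function $C:[2^n]\to[2^n+1]$ given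 by its bits (values in binary); a solution is $y\in[2^n+1]$ with $C(x)\neq y$ for all $x\in[2^n]$. $\mathsf{sAvoid}^{dt}$ is the class of problems $Q\in\mathrm{TF}\Sigma_2^{dt}$ with $Q\le_{dt}\mathrm{sAvoid}$. Linear Ordering Principle ($\mathrm{LOP}$): the input is a relation $\prec$ on $[N]$, $N=2^n$, given by bits $x_{i,j}$ ($i,j\in[N]$, $x_{i,j}=1$ meaning $i\prec j$); a solution is either an element $a$ with $a\prec b$ for every $b\neq a$ (minimal element), or distinct $a,b,c$ witnessing a violation of linear order: $a\prec a$, or ($a\not\prec b$ and $b\not\prec a$), or ($a\prec b$, $b\prec c$, $a\not\prec c$). *)

theory Defs
  imports Complex_Main "HOL-Library.Extended_Real"
begin

section \<open>Query search problems\<close>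

text \<open>
  A search problem is a family of relations indexed by \<open>k\<close>; the \<open>k\<close>-th relation is a subset of
  \<open>{0,1}^(inlen k) \<times> outs k\<close>. The input length is kept separate from the index because
  families such as LOP only have instances of particular lengths. Polylogarithmic
  bounds are always in terms of \<open>inlen k\<close>, not of \<open>k\<close>.
\<close>

record 'a search_problem =
  inlen :: "nat \<Rightarrow> nat"
  outs :: "nat \<Rightarrow> 'a set"
  sol :: "nat \<Rightarrow> bool list \<Rightarrow> 'a \<Rightarrow> bool"

definition cube :: "nat \<Rightarrow> bool list set" where
  "cube n = {x. length x = n}"

definition total :: "'a search_problem \<Rightarrow> bool" where
  "total R \<longleftrightarrow> (\<forall>k. \<forall>x \<in> cube (inlen R k). \<exists>a \<in> outs R k. sol R k x a)"

text \<open>The shift by 2 keeps the logarithm at least 1, so that very short inputs need no exception.\<close>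

definition polylog :: "(nat \<Rightarrow> nat) \<Rightarrow> (nat \<Rightarrow> ereal) \<Rightarrow> bool" where
  "polylog len f \<longleftrightarrow>
     (\<exists>(C::real) (c::nat). \<forall>k. f k \<le> ereal (C * log 2 (real (len k + 2)) ^ c))"

section \<open>Decision trees\<close>

datatype 'a dtree = Leaf 'a | Query nat "'a dtree" "'a dtree"

fun run :: "'a dtree \<Rightarrow> bool list \<Rightarrow> 'a" where
  "run (Leaf a) x = a"
| "run (Query i l r) x = (if x ! i then run r x else run l x)"

fun depth :: "'a dtree \<Rightarrow> nat" where
  "depth (Leaf a) = 0"
| "depth (Query i l r) = Suc (max (depth l) (depth r))"

fun queries :: "'a dtree \<Rightarrow> nat set" where
  "queries (Leaf a) = {}"
| "queries (Query i l r) = insert i (queries l \<union> queries r)"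

definition dtrees :: "nat \<Rightarrow> 'a dtree set" where
  "dtrees n = {t. queries t \<subseteq> {..<n}}"

definition dt_depth :: "nat \<Rightarrow> (bool list \<Rightarrow> 'a) \<Rightarrow> enat" where
  "dt_depth n f = (INF t \<in> {t \<in> dtrees n. \<forall>x \<in> cube n. run t x = f x}. enat (depth t))"

definition TFSigma2_dt :: "'a search_problem set" where
  "TFSigma2_dt = {R. total R \<and>
     (\<exists>(d :: nat \<Rightarrow> nat) (l :: nat \<Rightarrow> nat) (V :: nat \<Rightarrow> 'a \<Rightarrow> bool list \<Rightarrow> bool dtree).
        polylog (inlen R) (\<lambda>k. ereal (real (d k))) \<and>
        polylog (inlen R) (\<lambda>k. ereal (real (l k))) \<and>
        (\<forall>k. \<forall>a \<in> outs R k.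
           (\<forall>z \<in> cube (l k). V k a z \<in> dtrees (inlen R k) \<and> depth (V k a z) \<le> d k) \<and>
           (\<forall>x \<in> cube (inlen R k).
              sol R k x a \<longleftrightarrow> (\<forall>z \<in> cube (l k). run (V k a z) x))))}"

section \<open>Formulations and reductions\<close>

definition is_formulation ::
  "'a search_problem \<Rightarrow> nat \<Rightarrow> 'b search_problem \<Rightarrow> nat \<Rightarrow>
   (nat \<Rightarrow> bool list \<Rightarrow> bool) \<Rightarrow> ('b \<Rightarrow> bool list \<Rightarrow> 'a) \<Rightarrow> bool" where
  "is_formulation R k S j f g \<longleftrightarrow>
     (\<forall>b \<in> outs S j. \<forall>x \<in> cube (inlen R k).
        g b x \<in> outs R k \<and>
        (sol S j (map (\<lambda>i. f i x) [0..<inlen S j]) b \<longrightarrow> sol R k x (g b x)))"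

definition formulation_depth ::
  "'a search_problem \<Rightarrow> nat \<Rightarrow> 'b search_problem \<Rightarrow> nat \<Rightarrow>
   (nat \<Rightarrow> bool list \<Rightarrow> bool) \<Rightarrow> ('b \<Rightarrow> bool list \<Rightarrow> 'a) \<Rightarrow> enat" where
  "formulation_depth R k S j f g =
     sup (SUP i \<in> {..<inlen S j}. dt_depth (inlen R k) (f i))
         (SUP b \<in> outs S j. dt_depth (inlen R k) (g b))"

text \<open>The infimum is \<open>\<infinity>\<close> if there is no formulation, and is attained otherwise.\<close>

definition reduction_complexity ::
  "'a search_problem \<Rightarrow> 'b search_problem \<Rightarrow> nat \<Rightarrow> ereal" where
  "reduction_complexity R S k =
     (INF (j, f, g) \<in> {(j, f, g). is_formulation R k S j f g}.
        ereal (log 2 (real (inlen S j))) + ereal_of_enat (formulation_depth R k S j f g))"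

definition dt_reducible :: "'a search_problem \<Rightarrow> 'b search_problem \<Rightarrow> bool"
    (infix "\<le>\<^sub>d\<^sub>t" 50) where
  "R \<le>\<^sub>d\<^sub>t S \<longleftrightarrow> polylog (inlen R) (reduction_complexity R S)"

section \<open>Strong Avoid\<close>

text \<open>
  Here \<open>[M] = {0..<M}\<close>, and the \<open>2 ^ n\<close> values of \<open>C\<close> are listed in consecutive blocks of
  \<open>n + 1\<close> bits, least significant bit first. Codes above \<open>2 ^ n\<close> are read as \<open>2 ^ n\<close>, so that
  every bit string denotes a function into \<open>[2 ^ n + 1]\<close>.
\<close>

definition sAvoid_fun :: "nat \<Rightarrow> bool list \<Rightarrow> nat \<Rightarrow> nat" where
  "sAvoid_fun n w u = min (2 ^ n) (horner_sum of_bool 2 (take (n + 1) (drop (u * (n + 1)) w)))"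

definition sAvoid :: "nat search_problem" where
  "sAvoid = \<lparr>
     inlen = (\<lambda>n. 2 ^ n * (n + 1)),
     outs = (\<lambda>n. {..<2 ^ n + 1}),
     sol = (\<lambda>n w y. \<forall>u < 2 ^ n. sAvoid_fun n w u \<noteq> y) \<rparr>"

definition sAvoid_dt :: "'a search_problem set" where
  "sAvoid_dt = {Q \<in> TFSigma2_dt. Q \<le>\<^sub>d\<^sub>t sAvoid}"

section \<open>The Linear Ordering Principle\<close>

datatype lop_solution =
    Minimal nat
  | Reflexive nat
  | Incomparable nat nat
  | Intransitive nat nat nat

definition lop_rel :: "nat \<Rightarrow> bool list \<Rightarrow> nat \<Rightarrow> nat \<Rightarrow> bool" where
  "lop_rel N x i j = x ! (i * N + j)"

fun lop_out :: "nat \<Rightarrow> lop_solution \<Rightarrow> bool" where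
  "lop_out N (Minimal a) \<longleftrightarrow> a < N"
| "lop_out N (Reflexive a) \<longleftrightarrow> a < N"
| "lop_out N (Incomparable a b) \<longleftrightarrow> a < N \<and> b < N \<and> a \<noteq> b"
| "lop_out N (Intransitive a b c) \<longleftrightarrow> a < N \<and> b < N \<and> c < N \<and> distinct [a, b, c]"

fun lop_sol :: "nat \<Rightarrow> (nat \<Rightarrow> nat \<Rightarrow> bool) \<Rightarrow> lop_solution \<Rightarrow> bool" where
  "lop_sol N lt (Minimal a) \<longleftrightarrow> (\<forall>b < N. b \<noteq> a \<longrightarrow> lt a b)"
| "lop_sol N lt (Reflexive a) \<longleftrightarrow> lt a a"
| "lop_sol N lt (Incomparable a b) \<longleftrightarrow> \<not> lt a b \<and> \<not> lt b a"
| "lop_sol N lt (Intransitive a b c) \<longleftrightarrow> lt a b \<and> lt b c \<and> \<not> lt a c"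

definition LOP :: "lop_solution search_problem" where
  "LOP = \<lparr>
     inlen = (\<lambda>n. 2 ^ n * 2 ^ n),
     outs = (\<lambda>n. {s. lop_out (2 ^ n) s}),
     sol = (\<lambda>n x s. lop_sol (2 ^ n) (lop_rel (2 ^ n) x) s) \<rparr>"

end

theory Submission
  imports
    Defs
    "HOL-Combinatorics.Multiset_Permutations"
    "HOL-Computational_Algebra.Polynomial"
begin

text \<open>
  Take the uniform distribution on linear orders of \<open>[N]\<close>. For every output \<open>y\<close> of Strong Avoid
  there is a second distribution on orders which is indistinguishable from the uniform one by
  tests that look at few elements, and under which the tree \<open>g y\<close> never finds the minimum. Under
  that distribution \<open>y\<close> is always in the range of \<open>C\<close>, so the expected number of preimages of \<open>y\<close>
  is at least 1. The events \<open>C u = y\<close> are local tests, so the same holds under the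
  uniform distribution, and summing over the \<open>2 ^ m + 1\<close> values of \<open>y\<close> gives \<open>2 ^ m + 1 \<le> 2 ^ m\<close>.

  The second distribution has density \<open>1 - H\<close>. Suppose that \<open>g y\<close> outputs \<open>a\<close> after seeing a set
  \<open>S\<close> of elements of which \<open>a\<close> is the least, and let \<open>r\<close> be the rank of \<open>a\<close>. Then \<open>H\<close> is a function
  of \<open>r\<close> which is at most 1, equals 1 at \<open>r = 0\<close>, and is orthogonal to all local tests. The average
  of a local test at rank \<open>r\<close> is a polynomial of low degree in \<open>r\<close> (up to an explicit weight), so
  divided-difference coefficients on few nodes give such a function. The nodes are chosen
  quadratically spaced, as in the Chebyshev nodes, which keeps all coefficients but the one
  at 0 below 1/2 while the nodes stay polynomially small.
\<close>

section \<open>Divided-difference coefficients\<close>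

text \<open>The coefficient of \<open>f x\<close> in the divided difference of \<open>f\<close> over
  the nodes \<open>X\<close>, equivalently in the leading coefficient of the Lagrange
  interpolant.\<close>

definition dd_weight :: "real set \<Rightarrow> real \<Rightarrow> real" where
  "dd_weight X x = (\<Prod>z\<in>X - {x}. 1 / (x - z))"

lemma dd_weight_remove:
  assumes "finite X" "z \<in> X" "x \<in> X" "x \<noteq> z"
  shows "(x - z) * dd_weight X x = dd_weight (X - {z}) x"
proof -
  have "X - {x} = insert z (X - {z} - {x})" using assms by auto
  then have "dd_weight X x = 1 / (x - z) * dd_weight (X - {z}) x"
    using assms unfolding dd_weight_def by (simp add: prod.insert_remove)
  then show ?thesis using assms by simp
qed

text \<open>The factor \<open>x - z\<close> kills the term at \<open>z\<close> and cancels the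
  factor that \<open>z\<close> contributes to every other weight, so one node disappears.\<close>

lemma sum_dd_weight_linear:
  assumes "finite X" "z \<in> X"
  shows "(\<Sum>x\<in>X. dd_weight X x * ((x - z) * q x)) = (\<Sum>x\<in>X - {z}. dd_weight (X - {z}) x * q x)"
proof -
  have "(\<Sum>x\<in>X. dd_weight X x * ((x - z) * q x)) = (\<Sum>x\<in>X - {z}. dd_weight X x * ((x - z) * q x))"
    using assms by (subst sum.remove[of X z]) auto
  also have "\<dots> = (\<Sum>x\<in>X - {z}. dd_weight (X - {z}) x * q x)"
  proof (intro sum.cong refl)
    fix x assume "x \<in> X - {z}"
    then have "(x - z) * dd_weight X x = dd_weight (X - {z}) x"
      using dd_weight_remove[OF assms] by simp
    then show "dd_weight X x * ((x - z) * q x) = dd_weight (X - {z}) x * q x"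
      by (metis mult.assoc mult.commute)
  qed
  finally show ?thesis .
qed

text \<open>The recurrence of divided differences, applied to the constant 1: the sum over
  \<open>X\<close>, times \<open>y - z\<close>, is the difference of the sums over
  \<open>X - {z}\<close> and \<open>X - {y}\<close>, which agree.\<close>

lemma sum_dd_weight_eq_0:
  assumes "finite X" "card X \<ge> 2"
  shows "(\<Sum>x\<in>X. dd_weight X x) = 0"
  using assms
proof (induction "card X" arbitrary: X)
  case (Suc n)
  obtain y z where yz: "y \<in> X" "z \<in> X" "y \<noteq> z"
    using Suc.prems by (metis Suc.prems(2) card_le_Suc0_iff_eq not_less_eq_eq numeral_2_eq_2)
  define s where "s Y = (\<Sum>x\<in>Y. dd_weight Y x)" for Y
  have eq: "s (X - {y}) = s (X - {z})"
  \<comment> \<open>With two nodes the smaller sets are singletons, whose only weight is the empty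
    product 1; with more nodes both sums are 0 by induction.\<close>
  proof (cases "n = 1")
    case True
    then have "X = {y, z}" using yz Suc.hyps Suc.prems
      by (intro card_seteq[symmetric]) auto
    then have "X - {y} = {z}" "X - {z} = {y}" using yz by auto
    then show ?thesis by (simp add: s_def dd_weight_def)
  next
    case False
    then show ?thesis using Suc.hyps(1)[of "X - {y}"] Suc.hyps(1)[of "X - {z}"] Suc.hyps(2) Suc.prems yz
      by (simp add: s_def)
  qed
  have "(y - z) * s X = (\<Sum>x\<in>X. dd_weight X x * ((x - z) * 1)) - (\<Sum>x\<in>X. dd_weight X x * ((x - y) * 1))"
    by (simp add: s_def sum_subtractf[symmetric] sum_distrib_left algebra_simps)
  also have "\<dots> = 0"
    unfolding sum_dd_weight_linear[OF Suc.prems(1) yz(1)] sum_dd_weight_linear[OF Suc.prems(1) yz(2)]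
    using eq by (simp add: s_def)
  finally show ?case using yz by (simp add: s_def)
qed simp

text \<open>Dividing \<open>p\<close> by \<open>x - z\<close> lowers the degree and the number of
  nodes by one each; the remainder is a constant, which the weights annihilate.\<close>

lemma sum_dd_weight_poly:
  assumes "finite X" "degree p + 2 \<le> card X"
  shows "(\<Sum>x\<in>X. dd_weight X x * poly p x) = 0"
  using assms
proof (induction "degree p" arbitrary: p X)
  case 0
  then obtain c where "p = [:c:]" by (metis degree_eq_zeroE)
  then show ?case using sum_dd_weight_eq_0[OF 0(2)] 0 by (simp add: sum_distrib_right[symmetric])
next
  case (Suc n)
  obtain z where z: "z \<in> X" using Suc.prems by fastforce
  define q where "q = synthetic_div p z"
  have p: "poly p x = poly p z + (x - z) * poly q x" for x
  proof -
    have "poly ([:-z, 1:] * q + [:poly p z:]) x = poly p x"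
      unfolding q_def synthetic_div_correct' ..
    then show ?thesis by (simp add: algebra_simps)
  qed
  have q: "n = degree q" using Suc.hyps(2) by (simp add: q_def degree_synthetic_div)
  have "(\<Sum>x\<in>X. dd_weight X x * poly p x) =
     (\<Sum>x\<in>X. dd_weight X x * poly p z + dd_weight X x * ((x - z) * poly q x))"
    by (subst p) (simp add: algebra_simps)
  also have "\<dots> = (\<Sum>x\<in>X. dd_weight X x) * poly p z + (\<Sum>x\<in>X - {z}. dd_weight (X - {z}) x * poly q x)"
    by (simp only: sum.distrib sum_dd_weight_linear[OF Suc.prems(1) z] sum_distrib_right)
  also have "\<dots> = 0"
    using sum_dd_weight_eq_0[OF Suc.prems(1)] Suc.hyps(1)[OF q, of "X - {z}"] Suc.hyps(2) Suc.prems z q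
    by auto
  finally show ?case .
qed

text \<open>
  The node 1 next to 0 damps the coefficients of all other nodes: the squares alone would give
  coefficients of size up to 2.
\<close>

definition nodes :: "nat \<Rightarrow> nat set" where
  "nodes K = insert 0 (insert 1 ((\<lambda>j. 5 * j\<^sup>2) ` {1..K}))"

text \<open>Normalised to be 1 at the node 0. The value 0 off the nodes makes it a function of all
  ranks.\<close>

definition node_weight :: "nat \<Rightarrow> nat \<Rightarrow> real" where
  "node_weight K r =
     (if r \<in> nodes K then dd_weight (real ` nodes K) (real r) / dd_weight (real ` nodes K) 0 else 0)"

lemma finite_nodes [simp]: "finite (nodes K)"
  by (simp add: nodes_def)

lemma nodes_le: "r \<in> nodes K \<Longrightarrow> r \<le> 1 + 5 * K\<^sup>2"
proof -
  have "5 * j\<^sup>2 \<le> 1 + 5 * K\<^sup>2" if "j \<le> K" for j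
    using that by (simp add: power_mono le_SucI)
  moreover assume "r \<in> nodes K"
  ultimately show ?thesis by (auto simp: nodes_def)
qed

lemma card_nodes: "card (nodes K) = K + 2"
proof -
  let ?S = "\<lambda>j::nat. 5 * j\<^sup>2"
  have "inj_on ?S {1..K}" by (auto simp: inj_on_def)
  then have card: "card (?S ` {1..K}) = K" by (simp add: card_image)
  have "1 \<noteq> ?S j" for j by presburger
  then have n1: "1 \<notin> ?S ` {1..K}" by blast
  have n0: "0 \<notin> insert 1 (?S ` {1..K})" by auto
  have fin: "finite (?S ` {1..K})" by simp
  show ?thesis
    unfolding nodes_def card_insert_disjoint[OF finite.insertI[OF fin] n0] card_insert_disjoint[OF fin n1] card
    by simp
qed

lemma dd_weight_neq_0: "finite X \<Longrightarrow> dd_weight X x \<noteq> 0"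
  by (auto simp: dd_weight_def)

lemma node_weight_0 [simp]: "node_weight K 0 = 1"
  using dd_weight_neq_0[of "real ` nodes K" 0] by (simp add: node_weight_def nodes_def)

lemma sum_node_weight_poly:
  assumes "degree p \<le> K"
  shows "(\<Sum>r\<in>nodes K. node_weight K r * poly p (real r)) = 0"
proof -
  let ?X = "real ` nodes K"
  have "(\<Sum>r\<in>nodes K. node_weight K r * poly p (real r)) =
     (\<Sum>r\<in>nodes K. dd_weight ?X (real r) * poly p (real r)) / dd_weight ?X 0"
    unfolding sum_divide_distrib by (intro sum.cong) (auto simp: node_weight_def)
  also have "(\<Sum>r\<in>nodes K. dd_weight ?X (real r) * poly p (real r)) = (\<Sum>x\<in>?X. dd_weight ?X x * poly p x)"
    by (subst sum.reindex) (auto simp: inj_on_def)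
  also have "\<dots> = 0"
    using assms by (intro sum_dd_weight_poly) (simp_all add: card_image card_nodes)
  finally show ?thesis by simp
qed

section \<open>Size of the coefficients at quadratically spaced nodes\<close>

lemma fact_sq_le: "i \<le> K \<Longrightarrow> (fact K)\<^sup>2 \<le> fact (K - i) * (fact (K + i) :: real)"
proof (induction i)
  case (Suc i)
  have "(fact K)\<^sup>2 \<le> fact (K - i) * (fact (K + i) :: real)" using Suc by simp
  also have "\<dots> = fact (K - Suc i) * (real (K - i) * fact (K + i))"
  proof -
    have "K - i = Suc (K - Suc i)" using Suc.prems by simp
    then have "fact (K - i) = real (K - i) * fact (K - Suc i)" by (metis fact_Suc)
    then show ?thesis by simp
  qed
  also have "\<dots> \<le> fact (K - Suc i) * fact (K + Suc i)"
    by (intro mult_left_mono) (auto intro!: mult_right_mono)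
  finally show ?case .
qed (simp add: power2_eq_square)

lemma prod_square_nodes_base:
  "1 \<le> i \<Longrightarrow> (\<Prod>j\<in>{1..<i}. (real j)\<^sup>2 / ((real i)\<^sup>2 - (real j)\<^sup>2)) = 2 * (fact i)\<^sup>2 / fact (2 * i)"
proof -
  assume i: "1 \<le> i"
  have f1: "(\<Prod>j\<in>{1..<i}. real j) = fact (i - 1)"
  proof -
    have "{1..<i} = {1..i - 1}" by auto
    then show ?thesis by (simp add: fact_prod)
  qed
  have f2: "(\<Prod>j\<in>{1..<i}. real i - real j) = fact (i - 1)"
  proof -
    have "(\<Prod>j\<in>{1..<i}. real i - real j) = (\<Prod>j\<in>{1..<i}. real j)"
      by (rule prod.reindex_bij_witness[of _ "\<lambda>j. i - j" "\<lambda>j. i - j"]) (auto simp: of_nat_diff)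
    then show ?thesis using f1 by simp
  qed
  have "(\<Prod>j\<in>{1..<n}. real i + real j) * fact i = fact (i + n - 1)" if "1 \<le> n" for n
    using that
  proof (induction n rule: dec_induct)
    case (step n)
    have "(\<Prod>j\<in>{1..<Suc n}. real i + real j) * fact i =
        ((\<Prod>j\<in>{1..<n}. real i + real j) * fact i) * real (i + n)"
      using step.hyps by (simp add: prod.atLeastLessThan_Suc)
    also have "\<dots> = real (i + n) * fact (i + n - 1)"
      unfolding step.IH by (rule mult.commute)
    also have "\<dots> = fact (i + Suc n - 1)"
      using step.hyps by (simp add: fact_reduce[of "i + n"])
    finally show ?case .
  qed simp
  from this[OF i] have f: "(\<Prod>j\<in>{1..<i}. real i + real j) * fact i = fact (2 * i - 1)"
    by (simp only: mult_2)
  have "fact (2 * i) = real (2 * i) * (fact (2 * i - 1) :: real)"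
    using i by (intro fact_reduce) simp
  then have f3: "(\<Prod>j\<in>{1..<i}. real i + real j) * fact i * (2 * real i) = fact (2 * i)"
    unfolding f by (simp only: of_nat_mult of_nat_numeral mult.commute)
  have "(\<Prod>j\<in>{1..<i}. (real j)\<^sup>2 / ((real i)\<^sup>2 - (real j)\<^sup>2)) =
     (\<Prod>j\<in>{1..<i}. real j)\<^sup>2 / ((\<Prod>j\<in>{1..<i}. real i - real j) * (\<Prod>j\<in>{1..<i}. real i + real j))"
proof -
    have "(real i)\<^sup>2 - (real j)\<^sup>2 = (real i - real j) * (real i + real j)" for j
      by (simp add: power2_eq_square algebra_simps)
    then show ?thesis by (simp add: prod_dividef prod_power_distrib prod.distrib)
  qed
  also have "\<dots> = fact (i - 1) / (\<Prod>j\<in>{1..<i}. real i + real j)"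
    unfolding f1 f2 by (simp add: power2_eq_square)
  also have "\<dots> = fact (i - 1) * (fact i * (2 * real i)) / fact (2 * i)"
    using i by (subst f3[symmetric]) (simp add: divide_simps)
  also have "\<dots> = 2 * (fact i)\<^sup>2 / fact (2 * i)"
    using i by (cases i) (auto simp: power2_eq_square algebra_simps)
  finally show ?thesis .
qed

text \<open>For the nodes 0, 1, 4, ..., \<open>K\<^sup>2\<close> this product is the modulus of the
  coefficient at \<open>i\<^sup>2\<close> relative to the one at 0. Raising \<open>K\<close> by one
  multiplies it by one factor, in which the difference of squares splits; by
  \<open>fact_sq_le\<close> the value is at most 2.\<close>

lemma prod_square_nodes:
  assumes "1 \<le> i" "i \<le> K"
  shows "(\<Prod>j\<in>{1..K} - {i}. (real j)\<^sup>2 / \<bar>(real j)\<^sup>2 - (real i)\<^sup>2\<bar>) = 2 * (fact K)\<^sup>2 / (fact (K - i) * fact (K + i))"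
  using assms(2)
proof (induction K rule: dec_induct)
  case base
  have "(\<Prod>j\<in>{1..i} - {i}. (real j)\<^sup>2 / \<bar>(real j)\<^sup>2 - (real i)\<^sup>2\<bar>) = (\<Prod>j\<in>{1..<i}. (real j)\<^sup>2 / ((real i)\<^sup>2 - (real j)\<^sup>2))"
  proof (intro prod.cong)
    fix j assume "j \<in> {1..<i}"
    then have "(real j)\<^sup>2 \<le> (real i)\<^sup>2" by (simp add: power_mono)
    then have "\<bar>(real j)\<^sup>2 - (real i)\<^sup>2\<bar> = (real i)\<^sup>2 - (real j)\<^sup>2" by linarith
    then show "(real j)\<^sup>2 / \<bar>(real j)\<^sup>2 - (real i)\<^sup>2\<bar> = (real j)\<^sup>2 / ((real i)\<^sup>2 - (real j)\<^sup>2)"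
      by (simp only:)
  qed (simp_all add: atLeastLessThan_def atLeastAtMost_def set_eq_iff, arith)
  then show ?case unfolding prod_square_nodes_base[OF assms(1)]
    by (simp only: mult_2[of i] diff_self_eq_0 fact_0 mult_1)
next
  case (step K)
  have "{1..Suc K} - {i} = insert (Suc K) ({1..K} - {i})" using step by auto
  then have "(\<Prod>j\<in>{1..Suc K} - {i}. (real j)\<^sup>2 / \<bar>(real j)\<^sup>2 - (real i)\<^sup>2\<bar>) =
     (real (Suc K))\<^sup>2 / \<bar>(real (Suc K))\<^sup>2 - (real i)\<^sup>2\<bar> * (2 * (fact K)\<^sup>2 / (fact (K - i) * fact (K + i)))"
    using step by simp
  also have "\<bar>(real (Suc K))\<^sup>2 - (real i)\<^sup>2\<bar> = real (Suc K - i) * real (Suc K + i)"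
  proof -
    have "(real i)\<^sup>2 \<le> (real (Suc K))\<^sup>2" using step.hyps by (intro power_mono) auto
    then have "\<bar>(real (Suc K))\<^sup>2 - (real i)\<^sup>2\<bar> = (real (Suc K))\<^sup>2 - (real i)\<^sup>2" by linarith
    also have "\<dots> = real (Suc K - i) * real (Suc K + i)"
      using step.hyps by (simp add: power2_eq_square of_nat_diff algebra_simps)
    finally show ?thesis .
  qed
  also have "(real (Suc K))\<^sup>2 / (real (Suc K - i) * real (Suc K + i)) * (2 * (fact K)\<^sup>2 / (fact (K - i) * fact (K + i)))
     = 2 * (real (Suc K) * fact K)\<^sup>2 / ((real (Suc K - i) * fact (K - i)) * (real (Suc K + i) * fact (K + i)))"
    by (simp only: power_mult_distrib times_divide_times_eq ac_simps)
  also have "\<dots> = 2 * (fact (Suc K))\<^sup>2 / (fact (Suc K - i) * fact (Suc K + i))"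
    using step by (simp add: Suc_diff_le)
  finally show ?case .
qed

text \<open>At the node 1 the weight is negative. At \<open>5 * i\<^sup>2\<close> the scale 5
  cancels from the product over the other squares, leaving at most 2, and the node 1 contributes the
  factor \<open>1 / (5 * i\<^sup>2 - 1)\<close>, which is at most 1/4.\<close>

lemma node_weight_le_half:
  assumes "r \<noteq> 0"
  shows "node_weight K r \<le> 1/2"
proof (cases "r \<in> nodes K")
  case True
  let ?X = "real ` nodes K" and ?S = "\<lambda>j. 5 * (real j)\<^sup>2"
  have X: "?X = insert 0 (insert 1 (?S ` {1..K}))" by (auto simp: nodes_def image_image)
  have inj: "inj_on ?S A" for A by (auto simp: inj_on_def)
  have n1: "?S j \<noteq> 1" for j
  proof
    assume "?S j = 1"
    then have "real (5 * j\<^sup>2) = real 1" by simp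
    then have "5 * j\<^sup>2 = (1::nat)" by (simp only: of_nat_eq_iff)
    then show False by presburger
  qed
  have n0: "?S j \<noteq> 0" if "j \<in> {1..K}" for j using that by simp
  have X0: "?X - {0} = insert 1 (?S ` {1..K})" unfolding X using n0 by auto
  have "1 \<notin> ?S ` {1..K}" using n1[symmetric] by blast
  then have w0: "dd_weight ?X 0 = (-1) * (\<Prod>j\<in>{1..K}. 1 / (- ?S j))"
    unfolding dd_weight_def X0 by (simp add: prod.reindex[OF inj])
  consider "r = 1" | i where "i \<in> {1..K}" "r = 5 * i\<^sup>2"
    using True assms by (auto simp: nodes_def)
  then show ?thesis
  proof cases
    case 1
    have "?X - {1} = insert 0 (?S ` {1..K})" unfolding X using n1[symmetric] by auto
    moreover have "0 \<notin> ?S ` {1..K}" using n0 by auto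
    ultimately have "dd_weight ?X 1 = (\<Prod>j\<in>{1..K}. 1 / (1 - ?S j))"
      unfolding dd_weight_def by (simp add: prod.reindex[OF inj])
    then have "node_weight K r = - ((\<Prod>j\<in>{1..K}. 1 / (1 - ?S j)) / (\<Prod>j\<in>{1..K}. 1 / (- ?S j)))"
      using True w0 by (simp add: node_weight_def 1)
    also have "(\<Prod>j\<in>{1..K}. 1 / (1 - ?S j)) / (\<Prod>j\<in>{1..K}. 1 / (- ?S j)) =
      (\<Prod>j\<in>{1..K}. ?S j / (?S j - 1))"
      unfolding prod_dividef[symmetric] by (intro prod.cong) (use n1 in \<open>auto simp: field_simps\<close>)
    also have "- \<dots> \<le> 0"
    proof -
      have "0 \<le> (\<Prod>j\<in>{1..K}. ?S j / (?S j - 1))"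
      proof (intro prod_nonneg ballI divide_nonneg_nonneg)
        fix j assume "j \<in> {1..K}"
        then have "1 \<le> (real j)\<^sup>2" by simp
        then show "0 \<le> ?S j - 1" by simp
      qed auto
      then show ?thesis by simp
    qed
    finally show ?thesis by simp
  next
    case (2 i)
    let ?J = "{1..K} - {i}"
    have r: "real r = ?S i" by (simp add: 2)
    have "?X - {real r} = insert 0 (insert 1 (?S ` ?J))"
      unfolding X r using n1[of i] n0[of i] 2 inj[of UNIV] by (auto simp: inj_on_def)
    moreover have "1 \<notin> ?S ` ?J" using n1[symmetric] by blast
    moreover have "0 \<notin> insert 1 (?S ` ?J)" using n0 by auto
    ultimately have wr: "dd_weight ?X (real r) = 1 / ?S i * (1 / (?S i - 1)) * (\<Prod>j\<in>?J. 1 / (?S i - ?S j))"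
      unfolding dd_weight_def r by (simp add: prod.reindex[OF inj])
    have w0': "dd_weight ?X 0 = 1 / ?S i * (\<Prod>j\<in>?J. 1 / (- ?S j))"
      unfolding w0 using 2 by (subst prod.remove[of "{1..K}" i]) auto
    have "node_weight K r = 1 / (?S i - 1) * ((\<Prod>j\<in>?J. 1 / (?S i - ?S j)) / (\<Prod>j\<in>?J. 1 / (- ?S j)))"
      using True wr w0' n0[of i] 2 by (simp add: node_weight_def)
    also have "(\<Prod>j\<in>?J. 1 / (?S i - ?S j)) / (\<Prod>j\<in>?J. 1 / (- ?S j)) =
       (\<Prod>j\<in>?J. (real j)\<^sup>2 / ((real j)\<^sup>2 - (real i)\<^sup>2))"
      unfolding prod_dividef[symmetric] by (intro prod.cong) (use inj[of UNIV] in \<open>auto simp: inj_on_def divide_simps algebra_simps\<close>)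
    also have "1 / (?S i - 1) * \<dots> \<le> \<bar>1 / (?S i - 1) * \<dots>\<bar>" by (rule abs_ge_self)
    also have "\<dots> = 1 / (?S i - 1) * (\<Prod>j\<in>?J. (real j)\<^sup>2 / \<bar>(real j)\<^sup>2 - (real i)\<^sup>2\<bar>)"
    proof -
      have "1 \<le> (real i)\<^sup>2" using 2 by simp
      then show ?thesis by (simp add: abs_mult abs_prod)
    qed
    also have "\<dots> \<le> 1 / (?S i - 1) * 2"
    proof (rule mult_left_mono)
      show "(\<Prod>j\<in>?J. (real j)\<^sup>2 / \<bar>(real j)\<^sup>2 - (real i)\<^sup>2\<bar>) \<le> 2"
        using fact_sq_le[of i K] 2 by (subst prod_square_nodes) (auto simp: divide_simps)
      have "1 \<le> (real i)\<^sup>2" using 2 by simp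
      then show "0 \<le> 1 / (?S i - 1)" by simp
    qed
    also have "\<dots> \<le> 1 / 2"
    proof -
      have "1 \<le> (real i)\<^sup>2" using 2 by simp
      then show ?thesis by (simp add: divide_simps)
    qed
    finally show ?thesis .
  qed
qed (simp add: node_weight_def)

section \<open>Ranks in random orders\<close>

text \<open>An absent element gets the length of the list, hence a rank above that of every element
  present.\<close>

definition rank :: "'a list \<Rightarrow> 'a \<Rightarrow> nat" where
  "rank xs a = length (takeWhile (\<lambda>v. v \<noteq> a) xs)"

definition restrict_to :: "'a set \<Rightarrow> 'a list \<Rightarrow> 'a list" where
  "restrict_to W xs = filter (\<lambda>v. v \<in> W) xs"

lemma rank_less_length: "a \<in> set xs \<Longrightarrow> rank xs a < length xs"
  by (induction xs) (auto simp: rank_def)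

lemma nth_rank: "a \<in> set xs \<Longrightarrow> xs ! rank xs a = a"
  using nth_length_takeWhile[of "\<lambda>v. v \<noteq> a" xs] rank_less_length[of a xs] by (simp add: rank_def)

lemma rank_eq_iff: "a \<in> set xs \<Longrightarrow> b \<in> set xs \<Longrightarrow> rank xs a = rank xs b \<longleftrightarrow> a = b"
  by (metis nth_rank)

lemma rank_restrict_to_less_iff:
  assumes "a \<in> W" "b \<in> W"
  shows "rank (restrict_to W xs) a < rank (restrict_to W xs) b \<longleftrightarrow> rank xs a < rank xs b"
  using assms by (induction xs) (auto simp: rank_def restrict_to_def)

lemma restrict_to_restrict_to: "A \<subseteq> W \<Longrightarrow> restrict_to A (restrict_to W xs) = restrict_to A xs"
  by (auto simp: restrict_to_def intro!: filter_cong)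

lemma restrict_to_permutations:
  "xs \<in> permutations_of_set V \<Longrightarrow> W \<subseteq> V \<Longrightarrow> restrict_to W xs \<in> permutations_of_set W"
  by (auto simp: restrict_to_def permutations_of_set_def)

lemma card_rank_less:
  assumes "distinct ys" "a \<in> set ys"
  shows "card {b \<in> set ys. rank ys b < rank ys a} = rank ys a"
proof -
  have "{b \<in> set ys. rank ys b < rank ys a} = set (take (rank ys a) ys)"
    using assms(2)
  proof (intro equalityI subsetI)
    fix b assume "b \<in> {b \<in> set ys. rank ys b < rank ys a}"
    then show "b \<in> set (take (rank ys a) ys)"
      using nth_rank[of b ys] rank_less_length[of a ys] assms(2)
      by (auto simp: in_set_conv_nth intro!: exI[of _ "rank ys b"])
  next
    fix b assume "b \<in> set (take (rank ys a) ys)"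
    then obtain i where i: "i < rank ys a" "i < length ys" "ys ! i = b"
      by (auto simp: in_set_conv_nth)
    then have "rank ys b = i"
      using assms(1) nth_rank[of b ys] rank_less_length[of b ys] nth_eq_iff_index_eq nth_mem by metis
    then show "b \<in> {b \<in> set ys. rank ys b < rank ys a}" using i nth_mem[of i ys] by simp
  qed
  then show ?thesis
    using assms rank_less_length[of a ys] by (simp add: distinct_card)
qed

section \<open>Inserting one element into an order\<close>

definition insert_at :: "nat \<Rightarrow> 'a \<Rightarrow> 'a list \<Rightarrow> 'a list" where
  "insert_at p v ys = take p ys @ v # drop p ys"

lemma rank_insert_at:
  assumes "a \<in> set ys" "a \<noteq> v"
  shows "rank (insert_at p v ys) a = (if p \<le> rank ys a then Suc (rank ys a) else rank ys a)"
  using assms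
proof (induction ys arbitrary: p)
  case (Cons y ys)
  then show ?case by (cases p) (auto simp: insert_at_def rank_def)
qed simp

lemma rank_insert_at_self: "v \<notin> set ys \<Longrightarrow> p \<le> length ys \<Longrightarrow> rank (insert_at p v ys) v = p"
proof (induction ys arbitrary: p)
  case (Cons y ys)
  then show ?case by (cases p) (auto simp: insert_at_def rank_def)
qed (simp add: insert_at_def rank_def)

lemma permutations_restrict_to_insert:
  assumes "v \<notin> W" "ys \<in> permutations_of_set W"
  shows "{xs \<in> permutations_of_set (insert v W). restrict_to W xs = ys} =
         (\<lambda>p. insert_at p v ys) ` {..length ys}"
proof (intro equalityI subsetI)
  fix xs assume "xs \<in> {xs \<in> permutations_of_set (insert v W). restrict_to W xs = ys}"
  then have xs: "set xs = insert v W" "distinct xs" "restrict_to W xs = ys"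
    by (auto simp: permutations_of_set_def)
  then obtain us vs where us: "xs = us @ v # vs" by (metis insertI1 split_list)
  with xs assms have "set us \<subseteq> W" "set vs \<subseteq> W" by auto
  then have "ys = us @ vs"
    using xs(3) assms(1) us by (auto simp: restrict_to_def filter_id_conv subset_iff)
  then show "xs \<in> (\<lambda>p. insert_at p v ys) ` {..length ys}"
    using us by (intro image_eqI[of _ _ "length us"]) (auto simp: insert_at_def)
next
  fix xs assume "xs \<in> (\<lambda>p. insert_at p v ys) ` {..length ys}"
  then obtain p where p: "xs = insert_at p v ys" by auto
  have ys: "set ys = W" "distinct ys" using assms(2) by (auto simp: permutations_of_set_def)
  have tw: "set (take p ys) \<union> set (drop p ys) = W"
    using ys(1) by (metis append_take_drop_id set_append)
  moreover have "set (take p ys) \<inter> set (drop p ys) = {}"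
    using ys(2) by (metis append_take_drop_id distinct_append)
  ultimately have "set xs = insert v W" "distinct xs"
    using ys assms(1) by (auto simp: p insert_at_def)
  moreover have "restrict_to W xs = ys"
  proof -
    have "filter (\<lambda>v. v \<in> W) (take p ys) = take p ys" "filter (\<lambda>v. v \<in> W) (drop p ys) = drop p ys"
      using tw by (auto simp: filter_id_conv)
    then show ?thesis using assms(1) by (simp add: p insert_at_def restrict_to_def)
  qed
  ultimately show "xs \<in> {xs \<in> permutations_of_set (insert v W). restrict_to W xs = ys}"
    by (auto simp: permutations_of_set_def)
qed

text \<open>Of the \<open>card W + 1\<close> positions for \<open>v\<close>, the
  \<open>rank ys a + 1\<close> ones up to that of \<open>a\<close> raise the rank of
  \<open>a\<close> by one; the others leave it unchanged.\<close>

lemma sum_rank_insert: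
  fixes \<psi> :: "nat \<Rightarrow> real"
  assumes "v \<notin> W" "ys \<in> permutations_of_set W" "a \<in> W"
  shows "(\<Sum>xs | xs \<in> permutations_of_set (insert v W) \<and> restrict_to W xs = ys. \<psi> (rank xs a)) =
         real (rank ys a + 1) * \<psi> (rank ys a + 1) + real (card W - rank ys a) * \<psi> (rank ys a)"
proof -
  let ?r = "rank ys a"
  have ys: "set ys = W" "distinct ys" using assms(2) by (auto simp: permutations_of_set_def)
  have len: "length ys = card W" using ys distinct_card by force
  have r: "?r < card W" using rank_less_length[of a ys] ys assms(3) len by simp
  have "inj_on (\<lambda>p. insert_at p v ys) {..length ys}"
    using rank_insert_at_self[of v ys] ys(1) assms(1) by (auto simp: inj_on_def) metis
  then have "(\<Sum>xs | xs \<in> permutations_of_set (insert v W) \<and> restrict_to W xs = ys. \<psi> (rank xs a)) =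
      (\<Sum>p\<le>card W. \<psi> (rank (insert_at p v ys) a))"
    using permutations_restrict_to_insert[OF assms(1,2)] len by (simp add: sum.reindex)
  also have "\<dots> = (\<Sum>p\<le>card W. if p \<le> ?r then \<psi> (?r + 1) else \<psi> ?r)"
  proof -
    have "rank (insert_at p v ys) a = (if p \<le> ?r then ?r + 1 else ?r)" for p
      using assms ys by (subst rank_insert_at) auto
    then show ?thesis by (intro sum.cong) simp_all
  qed
  also have "\<dots> = (\<Sum>p\<in>{..?r}. \<psi> (?r + 1)) + (\<Sum>p\<in>{?r<..card W}. \<psi> ?r)"
  proof -
    have "{..card W} \<inter> {p. p \<le> ?r} = {..?r}" "{..card W} \<inter> - {p. p \<le> ?r} = {?r<..card W}"
      using r by auto
    then show ?thesis by (simp add: sum.If_cases)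
  qed
  finally show ?thesis by simp
qed

lemma permutations_restrict_to_fibres:
  assumes "finite V" "W \<subseteq> V"
  shows "(\<Sum>xs\<in>permutations_of_set V. f xs) =
         (\<Sum>ys\<in>permutations_of_set W. \<Sum>xs | xs \<in> permutations_of_set V \<and> restrict_to W xs = ys. f xs)"
  using assms restrict_to_permutations[of _ V W]
  by (intro sum.group[symmetric]) auto

text \<open>The number of choices of those among \<open>n\<close> new elements that come before
  \<open>a\<close>, if its rank is to grow from \<open>k\<close> to \<open>r\<close>. The case
  distinction guards against truncated subtraction.\<close>

definition choose_from :: "nat \<Rightarrow> nat \<Rightarrow> nat \<Rightarrow> nat" where
  "choose_from n r k = (if r < k then 0 else n choose (r - k))"

lemma choose_from_Suc: "choose_from (Suc n) r k = choose_from n r (Suc k) + choose_from n r k"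
proof (cases "k < r")
  case True
  then have "r - k = Suc (r - Suc k)" by simp
  then show ?thesis using True by (simp add: choose_from_def)
qed (auto simp: choose_from_def)

text \<open>Let \<open>a\<close> have rank \<open>k\<close> in \<open>ys\<close>. An extension in
  which it has rank \<open>r\<close> arises by choosing the \<open>r - k\<close> new elements before
  \<open>a\<close> and then arranging each side of \<open>a\<close>, where the relative order of the
  old elements is prescribed; this accounts for the two factorials in the denominator. The proof
  adds one element at a time and uses Pascal's rule.\<close>

lemma sum_rank_extensions:
  fixes \<phi> :: "nat \<Rightarrow> real"
  assumes "finite V" "W \<subseteq> V" "ys \<in> permutations_of_set W" "a \<in> W"
  shows "(\<Sum>xs | xs \<in> permutations_of_set V \<and> restrict_to W xs = ys. \<phi> (rank xs a)) =
     (\<Sum>r<card V. real (choose_from (card V - card W) r (rank ys a)) * fact r * fact (card V - 1 - r) * \<phi> r)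
       / (fact (rank ys a) * fact (card W - 1 - rank ys a))"
  using assms(2-4)
proof (induction "card V - card W" arbitrary: W ys)
  case 0
  then have W: "W = V" using assms(1) by (metis card_subset_eq card_mono diff_is_0_eq le_antisym)
  have ys: "set ys = V" "distinct ys" using 0 W by (auto simp: permutations_of_set_def)
  then have r: "rank ys a < card V" using 0 W rank_less_length[of a ys] by (metis distinct_card)
  have "{xs. xs \<in> permutations_of_set V \<and> restrict_to W xs = ys} = {ys}"
    using 0 W by (auto simp: restrict_to_def permutations_of_set_def filter_id_conv)
  moreover have "(\<Sum>r<card V. real (choose_from (card V - card W) r (rank ys a)) * fact r * fact (card V - 1 - r) * \<phi> r)
     = (\<Sum>r<card V. if r = rank ys a then fact r * fact (card V - 1 - r) * \<phi> r else 0)"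
    by (intro sum.cong) (auto simp: choose_from_def W)
  ultimately show ?case using r by (simp add: W)
next
  case (Suc n)
  let ?M = "card V" and ?k = "rank ys a"
  have cW: "card W < card V" using Suc.hyps(2) by simp
  then obtain v where v: "v \<in> V" "v \<notin> W" using Suc.prems(1) by (metis less_irrefl subsetI subset_antisym)
  have fW: "finite W" using assms(1) Suc.prems(1) by (rule finite_subset[rotated])
  then have cI: "card (insert v W) = Suc (card W)" using v by simp
  have n: "n = card V - card (insert v W)" using Suc.hyps(2) cI by simp
  have ys: "set ys = W" "distinct ys" using Suc.prems by (auto simp: permutations_of_set_def)
  have k: "?k < card W" using Suc.prems ys rank_less_length[of a ys] by (metis distinct_card)
  define \<Phi> where "\<Phi> k = (\<Sum>r<?M. real (choose_from n r k) * fact r * fact (?M - 1 - r) * \<phi> r)" for k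
  \<comment> \<open>The value that the induction hypothesis gives for an order of
    \<open>insert v W\<close>, a set with one element more than \<open>W\<close>; hence
    \<open>card W - k\<close> in place of \<open>card W - 1 - k\<close>.\<close>
  define \<psi> where "\<psi> k = \<Phi> k / (fact k * fact (card W - k))" for k
  have "(\<Sum>xs | xs \<in> permutations_of_set V \<and> restrict_to W xs = ys. \<phi> (rank xs a)) =
    (\<Sum>zs | zs \<in> permutations_of_set (insert v W) \<and> restrict_to W zs = ys.
      \<Sum>xs | xs \<in> {xs \<in> permutations_of_set V. restrict_to W xs = ys} \<and> restrict_to (insert v W) xs = zs. \<phi> (rank xs a))"
  proof (rule sum.group[symmetric])
    show "restrict_to (insert v W) ` {xs \<in> permutations_of_set V. restrict_to W xs = ys}
      \<subseteq> {zs \<in> permutations_of_set (insert v W). restrict_to W zs = ys}"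
      using v Suc.prems(1) restrict_to_permutations[of _ V "insert v W"]
      by (auto simp: restrict_to_restrict_to subset_insertI)
  qed auto
  also have "\<dots> = (\<Sum>zs | zs \<in> permutations_of_set (insert v W) \<and> restrict_to W zs = ys.
      \<Sum>xs | xs \<in> permutations_of_set V \<and> restrict_to (insert v W) xs = zs. \<phi> (rank xs a))"
    by (intro sum.cong) (auto simp: restrict_to_restrict_to subset_insertI)
  also have "\<dots> = (\<Sum>zs | zs \<in> permutations_of_set (insert v W) \<and> restrict_to W zs = ys. \<psi> (rank zs a))"
  proof (intro sum.cong refl)
    fix zs assume "zs \<in> {zs \<in> permutations_of_set (insert v W). restrict_to W zs = ys}"
    then have "zs \<in> permutations_of_set (insert v W)" by simp
    from Suc.hyps(1)[OF n _ this] Suc.prems v cI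
    show "(\<Sum>xs | xs \<in> permutations_of_set V \<and> restrict_to (insert v W) xs = zs. \<phi> (rank xs a)) = \<psi> (rank zs a)"
      by (simp add: \<psi>_def \<Phi>_def n)
  qed
  also have "\<dots> = real (?k + 1) * \<psi> (?k + 1) + real (card W - ?k) * \<psi> ?k"
    using v Suc.prems by (intro sum_rank_insert) auto
  also have "real (?k + 1) * \<psi> (?k + 1) = \<Phi> (Suc ?k) / (fact ?k * fact (card W - 1 - ?k))"
    by (simp add: \<psi>_def divide_simps)
  also have "real (card W - ?k) * \<psi> ?k = \<Phi> ?k / (fact ?k * fact (card W - 1 - ?k))"
  proof -
    obtain l where l: "card W - ?k = Suc l" using k by (metis Suc_diff_Suc)
    then have "card W - 1 - ?k = l" by simp
    then show ?thesis by (simp only: \<psi>_def l fact_Suc) (simp add: divide_simps del: of_nat_Suc)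
  qed
  also have "\<Phi> (Suc ?k) / (fact ?k * fact (card W - 1 - ?k)) + \<Phi> ?k / (fact ?k * fact (card W - 1 - ?k)) =
     (\<Phi> (Suc ?k) + \<Phi> ?k) / (fact ?k * fact (card W - 1 - ?k))"
    by (rule add_divide_distrib[symmetric])
  also have "\<Phi> (Suc ?k) + \<Phi> ?k = (\<Sum>r<?M. real (choose_from (?M - card W) r ?k) * fact r * fact (?M - 1 - r) * \<phi> r)"
    unfolding \<Phi>_def sum.distrib[symmetric] Suc.hyps(2)[symmetric]
    by (intro sum.cong) (auto simp: choose_from_Suc algebra_simps)
  finally show ?case .
qed

text \<open>
  A least element \<open>a\<close> of a set of size \<open>s\<close> has rank \<open>r\<close> in a uniformly random order with
  probability proportional to \<open>fact (N - 1 - r) / fact (N - s - r)\<close>. Dividing by this weight turns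
  the orthogonality of \<open>node_weight\<close> to polynomials into orthogonality to local tests.
\<close>

definition profile :: "nat \<Rightarrow> nat \<Rightarrow> nat \<Rightarrow> nat \<Rightarrow> real" where
  "profile N K s r = node_weight K r * (fact (N - s - r) / fact (N - 1 - r)) * (fact (N - 1) / fact (N - s))"

lemma profile_0 [simp]: "profile N K s 0 = 1"
  by (simp add: profile_def)

text \<open>The quotient of the factorials is a product of \<open>t\<close> factors
  \<open>(N - s - i) / (N - 1 - i)\<close>. Each is at least \<open>1 - s / (N - r)\<close>, and
  Bernoulli's inequality bounds the product.\<close>

lemma fact_ratio_bound:
  fixes s r t N :: nat
  assumes "1 \<le> s" "s + r \<le> N" "t \<le> r"
  shows "fact (N - 1) * fact (N - s - t) * (1 - real t * (real s / real (N - r))) \<le> fact (N - s) * (fact (N - 1 - t) :: real)"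
  using assms(3)
proof (induction t)
  case (Suc t)
  let ?e = "real s / real (N - r)"
  have e: "0 \<le> ?e" by simp
  define a where "a = N - s - Suc t"
  define b where "b = N - 1 - Suc t"
  have a: "N - s - t = Suc a" and b: "N - 1 - t = Suc b"
    using assms Suc.prems by (auto simp: a_def b_def)
  have "Suc a + (s - 1) = Suc b" using assms a b Suc.prems by linarith
  have "?e \<le> 1" using assms by (simp add: divide_simps)
  have ratio: "1 - ?e \<le> real (Suc a) / real (Suc b)"
  proof -
    have "real (Suc a) = real (Suc b) - real (s - 1)"
      using \<open>Suc a + (s - 1) = Suc b\<close> by linarith
    then have eq: "real (Suc a) / real (Suc b) = 1 - real (s - 1) / real (Suc b)"
      by (simp add: diff_divide_distrib del: of_nat_Suc)
    have "real (s - 1) / real (Suc b) \<le> ?e"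
      using assms Suc.prems b by (intro frac_le) linarith+
    then show ?thesis unfolding eq by (rule diff_left_mono)
  qed
  have "(1 - e) * (1 - real t * e) = (1 - real (Suc t) * e) + real t * (e * e)" for e :: real
    by (simp add: algebra_simps)
  then have "1 - real (Suc t) * ?e \<le> (1 - ?e) * (1 - real t * ?e)"
    by (simp only:) simp
  then have "fact (N - 1) * fact a * (1 - real (Suc t) * ?e) \<le> fact (N - 1) * fact a * ((1 - ?e) * (1 - real t * ?e))"
    by (intro mult_left_mono) auto
  also have "\<dots> \<le> fact (N - s) * fact b"
  \<comment> \<open>Multiplying the bound on the new factor by \<open>1 - real t * ?e\<close> needs
    this sign; if it is negative, the left side is at most 0.\<close>
  proof (cases "0 \<le> 1 - real t * ?e")
    case True
    have "fact (N - 1) * fact a * ((1 - ?e) * (1 - real t * ?e))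
        \<le> fact (N - 1) * fact a * (real (Suc a) / real (Suc b) * (1 - real t * ?e))"
      using ratio True by (intro mult_left_mono mult_right_mono) auto
    also have "\<dots> = fact (N - 1) * fact (Suc a) * (1 - real t * ?e) / real (Suc b)"
      by simp
    also have "\<dots> \<le> fact (N - s) * fact (Suc b) / real (Suc b)"
      using Suc.IH Suc.prems unfolding a b by (intro divide_right_mono) auto
    also have "\<dots> = fact (N - s) * fact b"
      by (simp del: of_nat_Suc)
    finally show ?thesis .
  next
    case False
    then have le_0: "(1 - ?e) * (1 - real t * ?e) \<le> 0"
      using \<open>?e \<le> 1\<close> by (intro mult_nonneg_nonpos) auto
    have "fact (N - 1) * fact a * ((1 - ?e) * (1 - real t * ?e)) \<le> 0"
      by (rule mult_nonneg_nonpos[OF _ le_0]) simp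
    also have "0 \<le> fact (N - s) * (fact b :: real)" by simp
    finally show ?thesis .
  qed
  finally show ?case by (simp add: a_def b_def)
qed simp

text \<open>The hypothesis gives \<open>s + r + 2 * s * r \<le> N\<close> at every node
  \<open>r\<close>. Then the factorial ratio is at most 2, which the bound 1/2 on the coefficients
  away from 0 absorbs.\<close>

lemma profile_le_1:
  assumes "1 \<le> s" "s + 2 * s * (1 + 5 * K\<^sup>2) + (1 + 5 * K\<^sup>2) \<le> N"
  shows "profile N K s r \<le> 1"
proof (cases "r = 0 \<or> node_weight K r \<le> 0")
  case True
  then show ?thesis
  proof
    assume "node_weight K r \<le> 0"
    then have "profile N K s r \<le> 0"
      unfolding profile_def by (intro mult_nonpos_nonneg) auto
    then show ?thesis by simp
  qed simp
next
  case False
  then have "r \<in> nodes K" by (auto simp: node_weight_def split: if_splits)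
  then have r: "r \<le> 1 + 5 * K\<^sup>2" by (rule nodes_le)
  have sr: "2 * s * r \<le> 2 * s * (1 + 5 * K\<^sup>2)" using r by (rule mult_le_mono2)
  have le: "s + r + 2 * s * r \<le> N" using assms(2) r sr by linarith
  have half: "1 / 2 \<le> 1 - real r * (real s / real (N - r))"
  proof -
    have "real (2 * s * r) \<le> real (N - r)" using le by (intro of_nat_mono) linarith
    moreover have "0 < real (N - r)" using le assms(1) by simp
    ultimately show ?thesis by (simp add: field_simps)
  qed
  have "fact (N - 1) * fact (N - s - r) * (1 / 2) \<le> fact (N - 1) * fact (N - s - r) * (1 - real r * (real s / real (N - r)))"
    using half by (intro mult_left_mono) auto
  also have "\<dots> \<le> fact (N - s) * (fact (N - 1 - r) :: real)"
    using fact_ratio_bound[of s r N r] assms(1) le by simp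
  finally have "fact (N - s - r) / fact (N - 1 - r) * (fact (N - 1) / fact (N - s)) \<le> (2 :: real)"
    by (simp add: field_simps)
  then have "node_weight K r * (fact (N - s - r) / fact (N - 1 - r) * (fact (N - 1) / fact (N - s))) \<le> 1 / 2 * 2"
    using node_weight_le_half[of r K] False by (intro mult_mono) auto
  then show ?thesis by (simp add: profile_def mult.assoc)
qed

section \<open>Orthogonality of the profile to local tests\<close>

lemma poly_falling:
  "poly (\<Prod>i<k. [:- real i, 1:]) (real n) = fact k * real (n choose k)"
  by (simp add: poly_prod binomial_gbinomial gbinomial_prod_rev lessThan_atLeast0 algebra_simps)

lemma poly_falling_reflected:
  assumes "n \<le> m"
  shows "poly (\<Prod>i<k. [:real m - real i, - 1:]) (real n) = fact k * real ((m - n) choose k)"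
proof -
  have "real (m - n) = real m - real n" using assms by simp
  then show ?thesis
    by (simp add: poly_prod binomial_gbinomial gbinomial_prod_rev lessThan_atLeast0 algebra_simps)
qed

text \<open>Apart from \<open>fact (N - w)\<close>, the right side is a falling factorial in
  \<open>r\<close> of length \<open>\<rho>\<close> times one in \<open>N - s - r\<close> of length
  \<open>w - s - \<rho>\<close>: a polynomial in \<open>r\<close> of degree
  \<open>w - s\<close>.\<close>

lemma choose_from_times_fact:
  assumes "\<rho> + s \<le> w" "w + r \<le> N"
  shows "real (choose_from (N - w) r \<rho>) * fact r * fact (N - s - r) =
     fact (N - w) * (fact \<rho> * real (r choose \<rho>)) * (fact (w - s - \<rho>) * real ((N - s - r) choose (w - s - \<rho>)))"
proof (cases "r < \<rho>")
  case False
  have 1: "fact r = fact \<rho> * fact (r - \<rho>) * real (r choose \<rho>)"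
    using binomial_fact_lemma[of \<rho> r] False by (metis linorder_not_le of_nat_fact of_nat_mult)
  have "w - s - \<rho> \<le> N - s - r" "N - s - r - (w - s - \<rho>) = (N - w) - (r - \<rho>)"
    using assms False by auto
  then have 2: "fact (N - s - r) = fact (w - s - \<rho>) * fact ((N - w) - (r - \<rho>)) * real ((N - s - r) choose (w - s - \<rho>))"
    using binomial_fact_lemma[of "w - s - \<rho>" "N - s - r"] by (metis of_nat_fact of_nat_mult)
  have "r - \<rho> \<le> N - w" using assms by auto
  then have 3: "fact (N - w) = fact (r - \<rho>) * fact ((N - w) - (r - \<rho>)) * real ((N - w) choose (r - \<rho>))"
    using binomial_fact_lemma[of "r - \<rho>" "N - w"] by (metis of_nat_fact of_nat_mult)
  show ?thesis
    unfolding 1 2 3 using False by (simp add: choose_from_def)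
qed (simp add: choose_from_def binomial_eq_0)

text \<open>The profile replaces \<open>fact (N - 1 - r)\<close> by \<open>fact (N - s - r)\<close>.
  What remains is \<open>node_weight\<close> times a polynomial in \<open>r\<close> of degree at
  most \<open>w - s \<le> K\<close>, which the \<open>K + 2\<close> nodes annihilate.\<close>

lemma sum_profile:
  assumes "1 \<le> s" "\<rho> + s \<le> w" "w \<le> s + K" "w + (1 + 5 * K\<^sup>2) \<le> N"
  shows "(\<Sum>r<N. real (choose_from (N - w) r \<rho>) * fact r * fact (N - 1 - r) * profile N K s r) = 0"
proof -
  let ?p = "(\<Prod>i<\<rho>. [:- real i, 1:]) * (\<Prod>i<w - s - \<rho>. [:real (N - s) - real i, - 1:])"
  \<comment> \<open>The nodes stay below the point where the natural-number subtractions would be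
    truncated.\<close>
  have nodes: "r \<le> N - w \<and> w + r \<le> N" if "r \<in> nodes K" for r
    using nodes_le[OF that] assms by linarith
  have deg: "degree (\<Prod>i\<in>I. [:f i, c:]) \<le> card I" if "finite I" for I :: "nat set" and f and c :: real
  proof -
    have "degree (\<Prod>i\<in>I. [:f i, c:]) \<le> (\<Sum>i\<in>I. degree [:f i, c:])"
      by (rule degree_prod_sum_le[OF that, unfolded o_def])
    also have "\<dots> \<le> (\<Sum>i\<in>I. 1)" by (intro sum_mono) auto
    finally show ?thesis by simp
  qed
  have "degree ?p \<le> K"
    using degree_mult_le[of "\<Prod>i<\<rho>. [:- real i, 1:]" "\<Prod>i<w - s - \<rho>. [:real (N - s) - real i, - 1:]"]
      deg[of "{..<\<rho>}" "\<lambda>i. - real i" 1] deg[of "{..<w - s - \<rho>}" "\<lambda>i. real (N - s) - real i" "-1"] assms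
    by simp
  have "(\<Sum>r<N. real (choose_from (N - w) r \<rho>) * fact r * fact (N - 1 - r) * profile N K s r) =
        (\<Sum>r\<in>nodes K. real (choose_from (N - w) r \<rho>) * fact r * fact (N - 1 - r) * profile N K s r)"
    using nodes assms by (intro sum.mono_neutral_right) (auto simp: profile_def node_weight_def, fastforce)
  also have "\<dots> = (\<Sum>r\<in>nodes K. fact (N - w) * (fact (N - 1) / fact (N - s)) * (node_weight K r * poly ?p (real r)))"
  proof (intro sum.cong refl)
    fix r assume r: "r \<in> nodes K"
    have "real (choose_from (N - w) r \<rho>) * fact r * fact (N - 1 - r) * profile N K s r =
      (real (choose_from (N - w) r \<rho>) * fact r * fact (N - s - r)) * (fact (N - 1) / fact (N - s)) * node_weight K r"
      by (simp add: profile_def)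
    also have "\<dots> = fact (N - w) * (fact (N - 1) / fact (N - s)) * (node_weight K r * poly ?p (real r))"
    proof -
      have "r \<le> N - s" using nodes[OF r] assms by linarith
      then have p: "poly ?p (real r) = (fact \<rho> * real (r choose \<rho>)) *
          (fact (w - s - \<rho>) * real ((N - s - r) choose (w - s - \<rho>)))"
        by (simp only: poly_mult poly_falling poly_falling_reflected)
      have "w + r \<le> N" using nodes[OF r] by simp
      show ?thesis
        unfolding choose_from_times_fact[OF assms(2) \<open>w + r \<le> N\<close>] p by (simp only: ac_simps)
    qed
    finally show "real (choose_from (N - w) r \<rho>) * fact r * fact (N - 1 - r) * profile N K s r =
      fact (N - w) * (fact (N - 1) / fact (N - s)) * (node_weight K r * poly ?p (real r))" .
  qed
  also have "\<dots> = 0"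
    unfolding sum_distrib_left[symmetric] using sum_node_weight_poly[OF \<open>degree ?p \<le> K\<close>] by simp
  finally show ?thesis .
qed

text \<open>\<open>S\<close> is what the tree has seen and \<open>W\<close> adds what the test sees.
  The sum vanishes on each fibre of the restriction to \<open>W\<close>: there \<open>Z\<close> is
  constant, and where it is nonzero all elements of \<open>W\<close> before \<open>a\<close> lie in
  \<open>W - S\<close>, which is the rank bound that \<open>sum_profile\<close> asks for.\<close>

lemma sum_profile_rank_orthogonal:
  assumes "finite V" "S \<subseteq> W" "W \<subseteq> V" "a \<in> S"
    and "card W \<le> card S + K" "card W + (1 + 5 * K\<^sup>2) \<le> card V"
    and Z: "\<And>ys b. Z ys \<noteq> 0 \<Longrightarrow> b \<in> S \<Longrightarrow> b \<noteq> a \<Longrightarrow> rank ys a < rank ys b"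
  shows "(\<Sum>xs\<in>permutations_of_set V. profile (card V) K (card S) (rank xs a) * Z (restrict_to W xs)) = 0"
proof -
  have fW: "finite W" using assms finite_subset by blast
  have "(\<Sum>xs | xs \<in> permutations_of_set V \<and> restrict_to W xs = ys.
      profile (card V) K (card S) (rank xs a) * Z (restrict_to W xs)) = 0"
    if ys: "ys \<in> permutations_of_set W" for ys
  proof (cases "Z ys = 0")
    case True
    then show ?thesis by (intro sum.neutral) auto
  next
    case False
    have sys: "set ys = W" "distinct ys" using ys by (auto simp: permutations_of_set_def)
    have "{b \<in> set ys. rank ys b < rank ys a} \<subseteq> W - S"
      using Z[OF False] sys by fastforce
    then have "rank ys a \<le> card (W - S)"
      using card_rank_less[of ys a] sys assms card_mono[of "W - S"] fW by (metis finite_Diff subsetD)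
    then have "rank ys a + card S \<le> card W"
      using assms(2) fW card_mono[OF fW assms(2)] finite_subset[OF assms(2) fW] by (simp add: card_Diff_subset)
    moreover have "1 \<le> card S"
      using assms(4) finite_subset[OF assms(2) fW] by (simp add: card_gt_0_iff Suc_le_eq) blast
    ultimately have "(\<Sum>r<card V. real (choose_from (card V - card W) r (rank ys a)) * fact r
        * fact (card V - 1 - r) * profile (card V) K (card S) r) = 0"
      using assms by (intro sum_profile) auto
    then have "(\<Sum>xs | xs \<in> permutations_of_set V \<and> restrict_to W xs = ys. profile (card V) K (card S) (rank xs a)) = 0"
      using assms by (subst sum_rank_extensions[OF assms(1,3) ys]) auto
    moreover have "(\<Sum>xs | xs \<in> permutations_of_set V \<and> restrict_to W xs = ys.
        profile (card V) K (card S) (rank xs a) * Z (restrict_to W xs)) =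
      (\<Sum>xs | xs \<in> permutations_of_set V \<and> restrict_to W xs = ys. profile (card V) K (card S) (rank xs a)) * Z ys"
      unfolding sum_distrib_right by (intro sum.cong) auto
    ultimately show ?thesis by simp
  qed
  then show ?thesis
    using assms by (subst permutations_restrict_to_fibres[OF assms(1,3)]) (simp add: sum.neutral)
qed

section \<open>Decision trees on linear orders\<close>

definition order_bits :: "nat \<Rightarrow> nat list \<Rightarrow> bool list" where
  "order_bits N xs = map (\<lambda>q. rank xs (q div N) < rank xs (q mod N)) [0..<N * N]"

lemma order_bits_in_cube [simp]: "order_bits N xs \<in> cube (N * N)"
  by (simp add: order_bits_def cube_def)

lemma nth_order_bits: "q < N * N \<Longrightarrow> order_bits N xs ! q \<longleftrightarrow> rank xs (q div N) < rank xs (q mod N)"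
  by (simp add: order_bits_def)

lemma lop_rel_order_bits:
  assumes "i < N" "j < N"
  shows "lop_rel N (order_bits N xs) i j \<longleftrightarrow> rank xs i < rank xs j"
proof -
  have "i * N + j < i * N + N" using assms by simp
  also have "\<dots> = Suc i * N" by simp
  also have "\<dots> \<le> N * N" using assms by (intro mult_le_mono1) simp
  finally show ?thesis using assms by (simp add: lop_rel_def nth_order_bits)
qed

text \<open>Comparison of ranks is irreflexive and transitive, and distinct elements have distinct
  ranks, so no violation can be reported.\<close>

lemma lop_sol_order_bits:
  assumes "xs \<in> permutations_of_set {..<N}" "lop_out N s" "lop_sol N (lop_rel N (order_bits N xs)) s"
  obtains a where "s = Minimal a" "a < N" "\<And>b. b < N \<Longrightarrow> b \<noteq> a \<Longrightarrow> rank xs a < rank xs b"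
proof -
  have set: "set xs = {..<N}" using assms(1) by (simp add: permutations_of_set_def)
  show thesis
  proof (cases s)
    case (Minimal a)
    then show thesis using assms that by (auto simp: lop_rel_order_bits)
  next
    case (Incomparable a b)
    then show thesis using assms rank_eq_iff[of a xs b] set by (auto simp: lop_rel_order_bits)
  qed (use assms in \<open>auto simp: lop_rel_order_bits\<close>)
qed

lemma rank_least_eq_0:
  assumes "xs \<in> permutations_of_set V" "a \<in> V" "\<And>b. b \<in> V \<Longrightarrow> b \<noteq> a \<Longrightarrow> rank xs a < rank xs b"
  shows "rank xs a = 0"
proof (rule ccontr)
  assume *: "rank xs a \<noteq> 0"
  have "set xs = V" using assms(1) by (simp add: permutations_of_set_def)
  then have "hd xs \<in> V" using assms(2) by (metis hd_in_set list.set(1) empty_iff)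
  moreover have "rank xs (hd xs) = 0" by (cases xs) (auto simp: rank_def)
  ultimately show False using assms(3)[of "hd xs"] * by (cases "hd xs = a") auto
qed

text \<open>The local tests. Over all its branches a shallow tree may touch many elements, but it is
  a sum of functions that each see few; orthogonality passes to such sums.\<close>

inductive junta_sum :: "nat set \<Rightarrow> nat \<Rightarrow> (nat list \<Rightarrow> real) \<Rightarrow> bool" for V K where
  junta: "U \<subseteq> V \<Longrightarrow> card U \<le> K \<Longrightarrow> junta_sum V K (\<lambda>xs. Q (restrict_to U xs))"
| add: "junta_sum V K f \<Longrightarrow> junta_sum V K g \<Longrightarrow> junta_sum V K (\<lambda>xs. f xs + g xs)"

lemma junta_sum_const: "junta_sum V K (\<lambda>_. c)"
  using junta_sum.junta[of "{}" V K "\<lambda>_. c"] by simp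

lemma junta_sum_mult:
  assumes "junta_sum V K f" "junta_sum V L g"
  shows "junta_sum V (K + L) (\<lambda>xs. f xs * g xs)"
  using assms(1)
proof (induction rule: junta_sum.induct)
  case (junta U Q)
  from assms(2) show ?case
  proof (induction rule: junta_sum.induct)
    case (junta U' Q')
    have "card (U \<union> U') \<le> K + L"
      using \<open>card U \<le> K\<close> junta.hyps card_Un_le[of U U'] by linarith
    then have "junta_sum V (K + L) (\<lambda>xs. (\<lambda>ys. Q (restrict_to U ys) * Q' (restrict_to U' ys)) (restrict_to (U \<union> U') xs))"
      using \<open>U \<subseteq> V\<close> junta.hyps by (intro junta_sum.junta) auto
    then show ?case by (simp add: restrict_to_restrict_to)
  next
    case (add f g)
    then show ?case by (simp add: distrib_left junta_sum.add)
  qed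
next
  case (add f g)
  then show ?case by (simp add: distrib_right junta_sum.add)
qed

lemma junta_sum_if:
  assumes "junta_sum V K (\<lambda>xs. of_bool (P xs))" "junta_sum V L f" "junta_sum V L g"
  shows "junta_sum V (K + L) (\<lambda>xs. if P xs then f xs else g xs)"
proof -
  have neg: "junta_sum V K (\<lambda>xs. 1 + (- 1) * of_bool (P xs))"
    using junta_sum_mult[OF junta_sum_const[of V 0 "- 1"] assms(1)]
    by (intro junta_sum.add junta_sum_const) simp
  have "junta_sum V (K + L) (\<lambda>xs. of_bool (P xs) * f xs + (1 + (- 1) * of_bool (P xs)) * g xs)"
    by (rule junta_sum.add[OF junta_sum_mult[OF assms(1,2)] junta_sum_mult[OF neg assms(3)]])
  then show ?thesis by (rule back_subst[of "junta_sum V (K + L)"]) auto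
qed

lemma query_lt:
  fixes q N :: nat
  assumes "q < N * N"
  shows "q div N < N" "q mod N < N"
proof -
  show "q div N < N" using assms by (simp add: less_mult_imp_div_less)
  have "N > 0" using assms by (cases N) auto
  then show "q mod N < N" by simp
qed

text \<open>Each query compares two elements, whence the factor 2; a branching is the sum of its two
  sides multiplied by the indicators of the answers.\<close>

lemma junta_sum_run:
  assumes "t \<in> dtrees (N * N)" "depth t \<le> d"
  shows "junta_sum {..<N} (2 * d) (\<lambda>xs. of_bool (P (run t (order_bits N xs))))"
  using assms
proof (induction t arbitrary: d)
  case (Leaf a)
  then show ?case by (simp add: junta_sum_const)
next
  case (Query q l r)
  then obtain e where d: "d = Suc e" by (cases d) auto
  have q: "q < N * N" using Query.prems by (simp add: dtrees_def)
  let ?U = "{q div N, q mod N}"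
  have "junta_sum {..<N} 2 (\<lambda>xs. (\<lambda>ys. of_bool (rank ys (q div N) < rank ys (q mod N))) (restrict_to ?U xs))"
    using query_lt[OF q] by (intro junta_sum.junta) (auto simp: card_insert_if)
  then have "junta_sum {..<N} 2 (\<lambda>xs. of_bool (order_bits N xs ! q))"
    by (simp add: rank_restrict_to_less_iff nth_order_bits[OF q])
  moreover have "junta_sum {..<N} (2 * e) (\<lambda>xs. of_bool (P (run r (order_bits N xs))))"
    "junta_sum {..<N} (2 * e) (\<lambda>xs. of_bool (P (run l (order_bits N xs))))"
    using Query.prems d by (auto intro!: Query.IH simp: dtrees_def)
  ultimately have "junta_sum {..<N} (2 + 2 * e) (\<lambda>xs. if order_bits N xs ! q then of_bool (P (run r (order_bits N xs)))
      else of_bool (P (run l (order_bits N xs))))"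
    by (rule junta_sum_if)
  moreover have "(\<lambda>xs. if order_bits N xs ! q then of_bool (P (run r (order_bits N xs)))
      else of_bool (P (run l (order_bits N xs)))) = (\<lambda>xs. of_bool (P (run (Query q l r) (order_bits N xs))) :: real)"
    by auto
  ultimately show ?case by (simp only: d mult_Suc_right)
qed

text \<open>The trees are run one after another, and the bits found so far are absorbed into
  \<open>G\<close>.\<close>

lemma junta_sum_run_list:
  fixes T :: "nat \<Rightarrow> bool dtree"
  assumes "\<And>i. i \<in> set is \<Longrightarrow> T i \<in> dtrees (N * N)" "\<And>i. i \<in> set is \<Longrightarrow> depth (T i) \<le> d"
  shows "junta_sum {..<N} (2 * d * length is) (\<lambda>xs. G (map (\<lambda>i. run (T i) (order_bits N xs)) is))"
  using assms
proof (induction "is" arbitrary: G)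
  case Nil
  then show ?case by (simp add: junta_sum_const)
next
  case (Cons i "is")
  have "junta_sum {..<N} (2 * d) (\<lambda>xs. of_bool (run (T i) (order_bits N xs)))"
    using Cons.prems by (intro junta_sum_run[of "T i" N d "\<lambda>b. b"]) auto
  moreover have "junta_sum {..<N} (2 * d * length is) (\<lambda>xs. G (b # map (\<lambda>i. run (T i) (order_bits N xs)) is))" for b
    using Cons.prems Cons.IH[of "\<lambda>bs. G (b # bs)"] by auto
  ultimately have "junta_sum {..<N} (2 * d + 2 * d * length is) (\<lambda>xs. if run (T i) (order_bits N xs)
      then G (True # map (\<lambda>i. run (T i) (order_bits N xs)) is) else G (False # map (\<lambda>i. run (T i) (order_bits N xs)) is))"
    by (intro junta_sum_if)
  moreover have "2 * d + 2 * d * length is = 2 * d * length (i # is)" by simp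
  moreover have "(\<lambda>xs. if run (T i) (order_bits N xs)
      then G (True # map (\<lambda>i. run (T i) (order_bits N xs)) is) else G (False # map (\<lambda>i. run (T i) (order_bits N xs)) is)) =
      (\<lambda>xs. G (map (\<lambda>i. run (T i) (order_bits N xs)) (i # is)))"
    by auto
  ultimately show ?case by (simp only:)
qed

text \<open>The set \<open>A\<close> accumulates the elements that the queries so far have touched.\<close>

fun correction :: "nat \<Rightarrow> nat \<Rightarrow> lop_solution dtree \<Rightarrow> nat set \<Rightarrow> nat list \<Rightarrow> real" where
  "correction N K (Leaf (Minimal a)) A xs =
     (if a < N \<and> (\<forall>b\<in>insert a A. b \<noteq> a \<longrightarrow> rank xs a < rank xs b)
      then profile N K (card (insert a A)) (rank xs a) else 0)"
| "correction N K (Leaf s) A xs = 0"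
| "correction N K (Query q l r) A xs =
     correction N K (if rank xs (q div N) < rank xs (q mod N) then r else l) ({q div N, q mod N} \<union> A) xs"

lemma card_insert_query: "card ({i, j} \<union> A) \<le> card A + 2"
  using card_Un_le[of "{i, j}" A] card_insert_le_m1[of 2 "{j}" i] by (simp add: card_insert_if split: if_splits)

text \<open>A query adds at most two elements to \<open>A\<close> and the output at most one, so
  \<open>s\<close> bounds the size of the set at every leaf.\<close>

lemma correction_le_1:
  assumes "finite A" "card A + 2 * depth t + 1 \<le> s"
    and "s + 2 * s * (1 + 5 * K\<^sup>2) + (1 + 5 * K\<^sup>2) \<le> N"
  shows "correction N K t A xs \<le> 1"
  using assms(1,2)
proof (induction t arbitrary: A)
  case (Leaf o')
  show ?case
  proof (cases o')
    case (Minimal a)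
    have "card (insert a A) \<le> s" using Leaf by (simp add: card_insert_if)
    \<comment> \<open>The largeness condition on \<open>N\<close> is monotone in \<open>s\<close>,
      so it passes to the actual size.\<close>
    then have "card (insert a A) * (1 + 2 * (1 + 5 * K\<^sup>2)) \<le> s * (1 + 2 * (1 + 5 * K\<^sup>2))"
      by (rule mult_le_mono1)
    then have "profile N K (card (insert a A)) (rank xs a) \<le> 1"
      using assms(3) Leaf(1) by (intro profile_le_1) (auto simp: algebra_simps card_gt_0_iff Suc_le_eq)
    then show ?thesis using Minimal by simp
  qed auto
next
  case (Query q l r)
  have *: "finite ({q div N, q mod N} \<union> A)" using Query.prems by simp
  show ?case
    using Query.IH(1)[OF *] Query.IH(2)[OF *] Query.prems card_insert_query[of "q div N" "q mod N" A] by auto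
qed

text \<open>\<open>correction\<close> follows the path of the tree on
  \<open>order_bits N xs\<close>; a true minimum passes the test at the leaf and has rank 0, where
  the profile is 1.\<close>

lemma correction_eq_1:
  assumes "xs \<in> permutations_of_set {..<N}" "t \<in> dtrees (N * N)" "A \<subseteq> {..<N}"
    and "run t (order_bits N xs) = Minimal a" "a < N" "\<And>b. b < N \<Longrightarrow> b \<noteq> a \<Longrightarrow> rank xs a < rank xs b"
  shows "correction N K t A xs = 1"
  using assms(2-4)
proof (induction t arbitrary: A)
  case (Leaf o')
  then have "rank xs a = 0" using rank_least_eq_0[OF assms(1), of a] assms(5,6) by auto
  moreover have "\<forall>b\<in>insert a A. b \<noteq> a \<longrightarrow> rank xs a < rank xs b"
    using assms(6) Leaf.prems(2) by auto
  ultimately show ?case using Leaf.prems(3) assms(5) by auto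
next
  case (Query q l r)
  have q: "q < N * N" using Query.prems by (simp add: dtrees_def)
  then show ?case
    using Query.IH[of "{q div N, q mod N} \<union> A"] Query.prems query_lt[OF q]
    by (auto simp: nth_order_bits dtrees_def split: if_splits)
qed

text \<open>The induction carries an arbitrary test \<open>P\<close> of the elements touched so far,
  into which each answer is absorbed. At a leaf everything depends on the order of
  \<open>insert a A \<union> U\<close>, which has at most \<open>K\<close> elements outside
  \<open>insert a A\<close>.\<close>

lemma correction_orthogonal:
  assumes "t \<in> dtrees (N * N)" "A \<subseteq> {..<N}" "card A + 2 * depth t + 1 \<le> s" "s + K + (1 + 5 * K\<^sup>2) \<le> N"
    and U: "U \<subseteq> {..<N}" "card U \<le> K"
  shows "(\<Sum>xs\<in>permutations_of_set {..<N}. correction N K t A xs * (P (restrict_to A xs) * Q (restrict_to U xs))) = 0"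
  using assms(1-3)
proof (induction t arbitrary: A P)
  case (Leaf o')
  show ?case
  proof (cases "\<exists>a<N. o' = Minimal a")
    case True
    then obtain a where a: "a < N" "o' = Minimal a" by auto
    let ?S = "insert a A" and ?W = "insert a A \<union> U"
    \<comment> \<open>The least-element condition of the leaf is moved into \<open>Z\<close>, which
      supplies the support hypothesis of \<open>sum_profile_rank_orthogonal\<close>.\<close>
    define Z where "Z ys = (if \<forall>b\<in>?S. b \<noteq> a \<longrightarrow> rank ys a < rank ys b
      then P (restrict_to A ys) * Q (restrict_to U ys) else 0)" for ys
    have fA: "finite A" using Leaf.prems finite_subset by blast
    have "card ?W \<le> card ?S + K" using card_Un_le[of ?S U] U by linarith
    moreover have "card ?S + K + (1 + 5 * K\<^sup>2) \<le> N"
      using fA Leaf.prems assms(4) by (simp add: card_insert_if)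
    ultimately have "(\<Sum>xs\<in>permutations_of_set {..<N}.
        profile (card {..<N}) K (card ?S) (rank xs a) * Z (restrict_to ?W xs)) = 0"
      using a Leaf.prems U
      by (intro sum_profile_rank_orthogonal) (auto simp: Z_def split: if_splits)
    moreover have "correction N K (Leaf o') A xs * (P (restrict_to A xs) * Q (restrict_to U xs)) =
        profile (card {..<N}) K (card ?S) (rank xs a) * Z (restrict_to ?W xs)" for xs
    proof -
      have "restrict_to A (restrict_to ?W xs) = restrict_to A xs" "restrict_to U (restrict_to ?W xs) = restrict_to U xs"
        by (auto intro!: restrict_to_restrict_to)
      moreover have "rank (restrict_to ?W xs) a < rank (restrict_to ?W xs) b \<longleftrightarrow> rank xs a < rank xs b" if "b \<in> ?S" for b
        using that by (intro rank_restrict_to_less_iff) auto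
      then have "(\<forall>b\<in>?S. b \<noteq> a \<longrightarrow> rank (restrict_to ?W xs) a < rank (restrict_to ?W xs) b) =
          (\<forall>b\<in>?S. b \<noteq> a \<longrightarrow> rank xs a < rank xs b)"
        by blast
      ultimately show ?thesis using a by (auto simp: Z_def)
    qed
    ultimately show ?thesis by simp
  next
    case False
    then have "correction N K (Leaf o') A xs = 0" for xs by (cases o') auto
    then show ?thesis by simp
  qed
next
  case (Query q l r)
  have q: "q < N * N" using Query.prems by (simp add: dtrees_def)
  let ?i = "q div N" and ?j = "q mod N"
  let ?A = "{?i, ?j} \<union> A"
  \<comment> \<open>The indicator that the query is answered by \<open>c\<close> joins the test, so
    each branch is an instance of the induction hypothesis.\<close>
  define P' where "P' c ys = of_bool ((rank ys ?i < rank ys ?j) = c) * P (restrict_to A ys)" for c ys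
  have P': "P' c (restrict_to ?A xs) = of_bool ((rank xs ?i < rank xs ?j) = c) * P (restrict_to A xs)" for c xs
  proof -
    have "rank (restrict_to ?A xs) ?i < rank (restrict_to ?A xs) ?j \<longleftrightarrow> rank xs ?i < rank xs ?j"
      by (rule rank_restrict_to_less_iff) auto
    moreover have "restrict_to A (restrict_to ?A xs) = restrict_to A xs"
      by (rule restrict_to_restrict_to) auto
    ultimately show ?thesis by (simp only: P'_def)
  qed
  have *: "?A \<subseteq> {..<N}" using Query.prems query_lt[OF q] by auto
  have c: "card ?A \<le> card A + 2" by (rule card_insert_query)
  have "(\<Sum>xs\<in>permutations_of_set {..<N}. correction N K (Query q l r) A xs * (P (restrict_to A xs) * Q (restrict_to U xs)))
    = (\<Sum>xs\<in>permutations_of_set {..<N}. correction N K r ?A xs * (P' True (restrict_to ?A xs) * Q (restrict_to U xs)))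
    + (\<Sum>xs\<in>permutations_of_set {..<N}. correction N K l ?A xs * (P' False (restrict_to ?A xs) * Q (restrict_to U xs)))"
    unfolding P' sum.distrib[symmetric] by (intro sum.cong) auto
  also have "\<dots> = 0"
    using Query.prems c Query.IH(2)[OF _ *, of "P' True"] Query.IH(1)[OF _ *, of "P' False"]
    by (auto simp: dtrees_def)
  finally show ?case .
qed

lemma correction_junta_sum:
  assumes "t \<in> dtrees (N * N)" "2 * depth t + 1 \<le> s" "s + K + (1 + 5 * K\<^sup>2) \<le> N" "junta_sum {..<N} K f"
  shows "(\<Sum>xs\<in>permutations_of_set {..<N}. correction N K t {} xs * f xs) = 0"
  using assms(4)
proof (induction rule: junta_sum.induct)
  case (junta U Q)
  then show ?case using correction_orthogonal[of t N "{}" s K U "\<lambda>_. 1" Q] assms by simp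
qed (simp add: distrib_left sum.distrib)

section \<open>Double counting for a shallow formulation\<close>

lemma dt_depth_obtain:
  assumes "dt_depth n F \<le> enat d"
  obtains t where "t \<in> dtrees n" "depth t \<le> d" "\<And>x. x \<in> cube n \<Longrightarrow> run t x = F x"
proof -
  \<comment> \<open>A strict bound extracts a tree from the infimum; depths are integers, so
    \<open>Suc d\<close> loses nothing.\<close>
  have "dt_depth n F < enat (Suc d)" using assms by (rule order_le_less_trans) simp
  then show thesis using that unfolding dt_depth_def INF_less_iff by auto
qed

lemma sAvoid_fun_map:
  assumes "u < 2 ^ m"
  shows "sAvoid_fun m (map h [0..<2 ^ m * (m + 1)]) u =
    min (2 ^ m) (horner_sum of_bool 2 (map h [u * (m + 1)..<u * (m + 1) + (m + 1)]))"
proof -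
  have "Suc u * (m + 1) \<le> 2 ^ m * (m + 1)" using assms by (intro mult_le_mono1) simp
  then have "u * (m + 1) + (m + 1) \<le> 2 ^ m * (m + 1)" by simp
  then have "take (m + 1) (drop (u * (m + 1)) (map h [0..<2 ^ m * (m + 1)])) = map h [u * (m + 1)..<u * (m + 1) + (m + 1)]"
    by (simp only: drop_map take_map drop_upt take_upt add_0)
  then show ?thesis by (simp only: sAvoid_fun_def)
qed

text \<open>\<open>K\<close> bounds the elements touched by the \<open>m + 1\<close> trees for the
  bits of one value, two per query; \<open>s\<close> bounds those touched by the tree for
  \<open>g y\<close>, together with its output.\<close>

lemma no_shallow_formulation:
  assumes form: "is_formulation LOP k sAvoid m f g"
    and depth: "formulation_depth LOP k sAvoid m f g \<le> enat d"
    and K: "K = 2 * d * (m + 1)" and s: "s = 2 * d + 1"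
    and large: "s + 2 * s * (1 + 5 * K\<^sup>2) + (1 + 5 * K\<^sup>2) + K \<le> 2 ^ k"
  shows False
proof -
  define N :: nat where "N = 2 ^ k"
  define M :: nat where "M = 2 ^ m"
  let ?\<Pi> = "permutations_of_set {..<N}"
  let ?x = "order_bits N"
  have len: "inlen LOP k = N * N" "inlen sAvoid m = M * (m + 1)" "outs sAvoid m = {..<M + 1}"
    by (simp_all add: LOP_def sAvoid_def N_def M_def)
  have "\<exists>t\<in>dtrees (N * N). depth t \<le> d \<and> (\<forall>x\<in>cube (N * N). run t x = f i x)" if "i < M * (m + 1)" for i
  proof -
    have "dt_depth (N * N) (f i) \<le> (SUP i \<in> {..<M * (m + 1)}. dt_depth (N * N) (f i))"
      using that by (intro SUP_upper) auto
    also have "\<dots> \<le> enat d" using depth unfolding formulation_depth_def len by simp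
    finally show ?thesis by (rule dt_depth_obtain) blast
  qed
  then obtain T where T: "\<And>i. i < M * (m + 1) \<Longrightarrow> T i \<in> dtrees (N * N)" "\<And>i. i < M * (m + 1) \<Longrightarrow> depth (T i) \<le> d"
    "\<And>i x. i < M * (m + 1) \<Longrightarrow> x \<in> cube (N * N) \<Longrightarrow> run (T i) x = f i x" by metis
  have "\<exists>t\<in>dtrees (N * N). depth t \<le> d \<and> (\<forall>x\<in>cube (N * N). run t x = g y x)" if "y < M + 1" for y
  proof -
    have "dt_depth (N * N) (g y) \<le> (SUP y \<in> {..<M + 1}. dt_depth (N * N) (g y))"
      using that by (intro SUP_upper) auto
    also have "\<dots> \<le> enat d" using depth unfolding formulation_depth_def len by simp
    finally show ?thesis by (rule dt_depth_obtain) blast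
  qed
  then obtain G where G: "\<And>y. y < M + 1 \<Longrightarrow> G y \<in> dtrees (N * N)" "\<And>y. y < M + 1 \<Longrightarrow> depth (G y) \<le> d"
    "\<And>y x. y < M + 1 \<Longrightarrow> x \<in> cube (N * N) \<Longrightarrow> run (G y) x = g y x" by metis
  define w where "w xs = map (\<lambda>i. f i (?x xs)) [0..<M * (m + 1)]" for xs
  define hits where "hits y u xs = (of_bool (sAvoid_fun m (w xs) u = y) :: real)" for y u xs
  have hits_junta: "junta_sum {..<N} K (hits y u)" if u: "u < M" for y u
  proof -
    let ?is = "[u * (m + 1)..<u * (m + 1) + (m + 1)]"
    have "Suc u * (m + 1) \<le> M * (m + 1)" using u by (intro mult_le_mono1) simp
    then have "is": "i < M * (m + 1)" if "i \<in> set ?is" for i using that by auto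
    have "junta_sum {..<N} (2 * d * length ?is) (\<lambda>xs. (\<lambda>bs. of_bool (min (2 ^ m) (horner_sum of_bool 2 bs) = y))
        (map (\<lambda>i. run (T i) (?x xs)) ?is))"
      using T(1,2)[OF "is"] by (rule junta_sum_run_list)
    moreover have "hits y u = (\<lambda>xs. (\<lambda>bs. of_bool (min (2 ^ m) (horner_sum of_bool 2 bs) = y))
        (map (\<lambda>i. run (T i) (?x xs)) ?is))"
    proof
      fix xs
      have "map (\<lambda>i. run (T i) (?x xs)) ?is = map (\<lambda>i. f i (?x xs)) ?is"
        using T(3)[OF "is"] by (intro map_cong refl) simp
      then show "hits y u xs = (\<lambda>bs. of_bool (min (2 ^ m) (horner_sum of_bool 2 bs) = y)) (map (\<lambda>i. run (T i) (?x xs)) ?is)"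
        using u by (simp only: hits_def w_def M_def sAvoid_fun_map)
    qed
    moreover have "length ?is = m + 1" by simp
    ultimately show ?thesis by (simp only: K)
  qed
  have hits_sum: "(\<Sum>y<M + 1. hits y u xs) = 1" for u xs
  proof -
    have "sAvoid_fun m (w xs) u < M + 1" by (simp add: sAvoid_fun_def M_def less_Suc_eq_le)
    then show ?thesis by (simp add: hits_def of_bool_def)
  qed
  have lower: "real (card ?\<Pi>) \<le> (\<Sum>xs\<in>?\<Pi>. \<Sum>u<M. hits y u xs)" if y: "y < M + 1" for y
  proof -
    define H where "H = correction N K (G y) {}"
    have H_le: "H xs \<le> 1" for xs
      unfolding H_def using G(2)[OF y] large s by (intro correction_le_1[of _ _ s]) (auto simp: N_def)
    have H_orth: "(\<Sum>xs\<in>?\<Pi>. H xs * h xs) = 0" if "junta_sum {..<N} K h" for h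
      unfolding H_def using G(1,2)[OF y] large s that by (intro correction_junta_sum[of _ _ s]) (auto simp: N_def)
    have H_sol: "H xs = 1" if xs: "xs \<in> ?\<Pi>" and avoid: "\<And>u. u < M \<Longrightarrow> sAvoid_fun m (w xs) u \<noteq> y" for xs
    proof -
      have "sol sAvoid m (w xs) y" using avoid by (simp add: sAvoid_def M_def)
      then have "g y (?x xs) \<in> outs LOP k" "sol LOP k (?x xs) (g y (?x xs))"
        using form y unfolding is_formulation_def len by (simp_all add: w_def)
      then have "lop_out N (g y (?x xs))" "lop_sol N (lop_rel N (?x xs)) (g y (?x xs))"
        by (simp_all add: LOP_def N_def)
      from lop_sol_order_bits[OF xs this] obtain a where
        "g y (?x xs) = Minimal a" "a < N" "\<And>b. b < N \<Longrightarrow> b \<noteq> a \<Longrightarrow> rank xs a < rank xs b" by blast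
      then show ?thesis
        unfolding H_def using xs G(1,3)[OF y] by (intro correction_eq_1[of _ _ _ _ a]) auto
    qed
    \<comment> \<open>\<open>1 - H\<close> is nonnegative with mean 1, the density of the second
      distribution.\<close>
    have "real (card ?\<Pi>) = (\<Sum>xs\<in>?\<Pi>. 1 - H xs)"
      using H_orth[OF junta_sum_const[of _ _ 1]] by (simp add: sum_subtractf)
    also have "\<dots> \<le> (\<Sum>xs\<in>?\<Pi>. (1 - H xs) * (\<Sum>u<M. hits y u xs))"
    proof (rule sum_mono)
      fix xs assume xs: "xs \<in> ?\<Pi>"
      show "1 - H xs \<le> (1 - H xs) * (\<Sum>u<M. hits y u xs)"
      \<comment> \<open>If \<open>y\<close> is hit, the number of preimages is at least 1; if not,
        \<open>y\<close> is a solution and the density is 0.\<close>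
      proof (cases "\<exists>u<M. sAvoid_fun m (w xs) u = y")
        case True
        then obtain u where "u < M" "hits y u xs = 1" by (auto simp: hits_def)
        then have "1 \<le> (\<Sum>u<M. hits y u xs)"
          using member_le_sum[of u "{..<M}" "\<lambda>u. hits y u xs"] by (simp add: hits_def)
        then show ?thesis using H_le[of xs] mult_left_mono[of 1 "\<Sum>u<M. hits y u xs" "1 - H xs"] by simp
      qed (use H_sol[OF xs] in auto)
    qed
    also have "\<dots> = (\<Sum>xs\<in>?\<Pi>. \<Sum>u<M. hits y u xs) - (\<Sum>u<M. \<Sum>xs\<in>?\<Pi>. H xs * hits y u xs)"
    proof -
      have "(\<Sum>u<M. \<Sum>xs\<in>?\<Pi>. H xs * hits y u xs) = (\<Sum>xs\<in>?\<Pi>. \<Sum>u<M. H xs * hits y u xs)"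
        by (rule sum.swap)
      then show ?thesis by (simp add: left_diff_distrib sum_subtractf sum_distrib_left)
    qed
    also have "(\<Sum>u<M. \<Sum>xs\<in>?\<Pi>. H xs * hits y u xs) = 0"
      using H_orth hits_junta by (intro sum.neutral) auto
    finally show ?thesis by simp
  qed
  \<comment> \<open>Each \<open>u\<close> hits exactly one of the \<open>M + 1\<close> values, so
    after exchanging the sums only the factor \<open>M\<close> remains.\<close>
  have "real (M + 1) * real (card ?\<Pi>) = (\<Sum>y<M + 1. real (card ?\<Pi>))" by simp
  also have "\<dots> \<le> (\<Sum>y<M + 1. \<Sum>xs\<in>?\<Pi>. \<Sum>u<M. hits y u xs)"
    using lower by (intro sum_mono) auto
  also have "\<dots> = (\<Sum>xs\<in>?\<Pi>. \<Sum>u<M. \<Sum>y<M + 1. hits y u xs)"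
    by (subst sum.swap, subst (2) sum.swap) simp
  also have "\<dots> = real (card ?\<Pi>) * real M" unfolding hits_sum by simp
  finally have "real (card ?\<Pi>) \<le> 0" by (simp add: algebra_simps)
  moreover have "card ?\<Pi> > 0" by (simp only: card_permutations_of_set finite_lessThan fact_gt_zero)
  ultimately show False by linarith
qed

section \<open>Parameters\<close>

text \<open>The limit of \<open>x ^ c / exp x\<close> along \<open>x = ln 2 * real (k + 1)\<close>,
  where \<open>exp x\<close> is a power of 2.\<close>

lemma power_times_const_le_exp2:
  fixes C :: real
  shows "\<forall>\<^sub>F k :: nat in sequentially. C * real (2 * k + 2) ^ c \<le> 2 ^ k"
proof -
  have "((\<lambda>x::real. x ^ c / exp x) \<longlongrightarrow> 0) at_top"
    by (rule tendsto_power_div_exp_0)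
  moreover have "filterlim (\<lambda>k::nat. ln 2 * real (k + 1)) at_top sequentially"
    by (intro filterlim_tendsto_pos_mult_at_top[OF tendsto_const] filterlim_compose[OF filterlim_real_sequentially])
       (auto intro: filterlim_Suc)
  ultimately have "(\<lambda>k. (ln 2 * real (k + 1)) ^ c / exp (ln 2 * real (k + 1))) \<longlonglongrightarrow> 0"
    by (rule filterlim_compose)
  \<comment> \<open>The factor \<open>(2 / ln 2) ^ c\<close> turns the power of
    \<open>ln 2 * real (k + 1)\<close> into that of \<open>2 * k + 2\<close>; the leading 2 makes up
    for \<open>2 ^ (k + 1)\<close> against \<open>2 ^ k\<close>.\<close>
  then have "(\<lambda>k. 2 * (C * (2 / ln 2) ^ c) * ((ln 2 * real (k + 1)) ^ c / exp (ln 2 * real (k + 1)))) \<longlonglongrightarrow>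
      2 * (C * (2 / ln 2) ^ c) * 0"
    by (intro tendsto_mult tendsto_const)
  then have "\<forall>\<^sub>F k in sequentially. 2 * (C * (2 / ln 2) ^ c) * ((ln 2 * real (k + 1)) ^ c / exp (ln 2 * real (k + 1))) < 1"
    by (intro order_tendstoD(2)) auto
  then show ?thesis
  proof eventually_elim
    case (elim k)
    have "exp (ln 2 * real (k + 1)) = (2::real) ^ (k + 1)"
      by (metis exp_ln exp_of_nat2_mult zero_less_numeral)
    moreover have "(2 / ln 2) ^ c * (ln 2 * real (k + 1)) ^ c = real (2 * k + 2) ^ c"
      unfolding power_mult_distrib[symmetric] by (rule arg_cong[of _ _ "\<lambda>x. x ^ c"]) simp
    ultimately have "2 * (C * real (2 * k + 2) ^ c) / 2 ^ (k + 1) < 1"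
      using elim by (simp add: mult.assoc)
    then show ?case by (simp add: divide_simps)
  qed
qed

text \<open>The dominant term is of order \<open>d\<close> times the square of \<open>d * m\<close>,
  hence the fifth power. The four summands contribute at most 3, 486, 81 and 4 times
  \<open>b ^ 5\<close>.\<close>

lemma size_bound:
  fixes b d m :: nat
  assumes "1 \<le> b" "d \<le> b" "m \<le> b"
  shows "(2 * d + 1) + 2 * (2 * d + 1) * (1 + 5 * (2 * d * (m + 1))\<^sup>2) + (1 + 5 * (2 * d * (m + 1))\<^sup>2) + 2 * d * (m + 1)
    \<le> 1000 * b ^ 5"
proof -
  have s: "2 * d + 1 \<le> 3 * b" using assms by simp
  have K: "2 * d * (m + 1) \<le> 4 * b ^ 2"
  proof -
    have "2 * d * (m + 1) \<le> (2 * b) * (2 * b)" using assms by (intro mult_le_mono) auto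
    then show ?thesis by (simp add: power2_eq_square)
  qed
  have b: "b ^ i \<le> b ^ 5" if "i \<le> 5" for i using assms(1) that by (intro power_increasing) auto
  have "(2 * d * (m + 1))\<^sup>2 \<le> (4 * b ^ 2)\<^sup>2" using K by (intro power_mono) auto
  then have R: "1 + 5 * (2 * d * (m + 1))\<^sup>2 \<le> 81 * b ^ 4"
  proof -
    have "1 \<le> b ^ 4" using assms(1) by simp
    moreover have "(2 * d * (m + 1))\<^sup>2 \<le> 16 * b ^ 4"
      using \<open>(2 * d * (m + 1))\<^sup>2 \<le> (4 * b ^ 2)\<^sup>2\<close> by (simp add: power_mult_distrib flip: power_mult)
    ultimately show ?thesis by linarith
  qed
  have "2 * (2 * d + 1) * (1 + 5 * (2 * d * (m + 1))\<^sup>2) \<le> 2 * (3 * b) * (81 * b ^ 4)"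
    using s R by (intro mult_le_mono) auto
  also have "\<dots> = 486 * b ^ 5" using power_Suc[of b 4] by simp
  finally show ?thesis
    using s K R b[of 1] b[of 2] b[of 4] by simp
qed

text \<open>Some formulation comes within 1 of the infimum, which explains \<open>B + 1\<close>; the
  input of Strong Avoid has at least \<open>2 ^ m\<close> bits, so the logarithm of its length
  bounds \<open>m\<close>.\<close>

lemma reduction_complexity_obtain:
  assumes "reduction_complexity LOP sAvoid k \<le> ereal B"
  obtains m f g d where "is_formulation LOP k sAvoid m f g" "formulation_depth LOP k sAvoid m f g = enat d"
    "real m \<le> B + 1" "real d \<le> B + 1"
proof -
  have "reduction_complexity LOP sAvoid k < ereal (B + 1)"
    using assms by (rule order_le_less_trans) simp
  then obtain m f g where form: "is_formulation LOP k sAvoid m f g" and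
    less: "ereal (log 2 (real (inlen sAvoid m))) + ereal_of_enat (formulation_depth LOP k sAvoid m f g) < ereal (B + 1)"
    unfolding reduction_complexity_def INF_less_iff by auto
  then obtain d where d: "formulation_depth LOP k sAvoid m f g = enat d"
    by (cases "formulation_depth LOP k sAvoid m f g") auto
  have "real m = log 2 (2 ^ m)" by simp
  also have "\<dots> \<le> log 2 (real (inlen sAvoid m))"
    by (subst log_le_cancel_iff) (auto simp: sAvoid_def intro: add_pos_nonneg)
  finally have m: "real m \<le> log 2 (real (inlen sAvoid m))" .
  have "log 2 (real (inlen sAvoid m)) + real d < B + 1" using less d by simp
  then show thesis using that[OF form d] m by simp
qed

lemma LOP_not_reducible_sAvoid: "\<not> LOP \<le>\<^sub>d\<^sub>t sAvoid"
proof
  assume "LOP \<le>\<^sub>d\<^sub>t sAvoid"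
  then obtain C c where C: "\<And>k. reduction_complexity LOP sAvoid k \<le> ereal (C * log 2 (real (inlen LOP k + 2)) ^ c)"
    unfolding dt_reducible_def polylog_def by blast
  \<comment> \<open>The summand 2 absorbs the additive 1 from the infimum and makes \<open>b\<close>
    below at least 1.\<close>
  define B where "B = \<bar>C\<bar> + 2"
  obtain k where k: "1000 * B ^ 5 * real (2 * k + 2) ^ (c * 5) \<le> 2 ^ k"
    using eventually_happens'[OF sequentially_bot power_times_const_le_exp2] by blast
  \<comment> \<open>The input length is \<open>4 ^ k\<close>, so its logarithm is linear in
    \<open>k\<close>: a polylogarithmic bound is polynomial in \<open>k\<close> and loses against
    \<open>2 ^ k\<close>.\<close>
  define L where "L = real (2 * k + 2)"
  have L: "1 \<le> L" by (simp add: L_def)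
  have "log 2 (real (inlen LOP k + 2)) \<le> L"
  proof -
    have "inlen LOP k + 2 = 2 ^ (2 * k) + 2" by (simp add: LOP_def power_add mult_2)
    also have "\<dots> \<le> 2 ^ (2 * k + 2)"
    proof -
      have "(1::nat) \<le> 2 ^ (2 * k)" by (rule one_le_power) simp
      moreover have "(2::nat) ^ (2 * k + 2) = 4 * 2 ^ (2 * k)" by (simp add: power_add)
      ultimately show ?thesis by linarith
    qed
    finally have "real (inlen LOP k + 2) \<le> real (2 ^ (2 * k + 2))" by (rule of_nat_mono)
    also have "real (2 ^ (2 * k + 2)) = 2 ^ (2 * k + 2)" by simp
    finally have "log 2 (real (inlen LOP k + 2)) \<le> log 2 (2 ^ (2 * k + 2))"
      by (subst log_le_cancel_iff) auto
    also have "\<dots> = L" unfolding L_def by (subst log_pow_cancel) auto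
    finally show ?thesis .
  qed
  moreover have "0 \<le> log 2 (real (inlen LOP k + 2))" by (subst zero_le_log_cancel_iff) auto
  ultimately have "log 2 (real (inlen LOP k + 2)) ^ c \<le> L ^ c" by (intro power_mono)
  then have "C * log 2 (real (inlen LOP k + 2)) ^ c \<le> \<bar>C\<bar> * L ^ c"
    using \<open>0 \<le> log 2 (real (inlen LOP k + 2))\<close> by (intro mult_mono) auto
  then have "reduction_complexity LOP sAvoid k \<le> ereal (\<bar>C\<bar> * L ^ c)"
    using C[of k] by (meson ereal_less_eq(3) order_trans)
  then obtain m f g d where form: "is_formulation LOP k sAvoid m f g" "formulation_depth LOP k sAvoid m f g = enat d"
    and md: "real m \<le> \<bar>C\<bar> * L ^ c + 1" "real d \<le> \<bar>C\<bar> * L ^ c + 1"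
    by (rule reduction_complexity_obtain)
  have BL: "\<bar>C\<bar> * L ^ c + 1 \<le> B * L ^ c - 1"
    using one_le_power[OF L, of c] by (simp add: B_def algebra_simps)
  define b where "b = nat \<lfloor>B * L ^ c\<rfloor>"
  have bB: "real b \<le> B * L ^ c"
    using one_le_power[OF L, of c] by (simp add: b_def B_def)
  have b: "1 \<le> b" "d \<le> b" "m \<le> b"
    using md BL one_le_power[OF L, of c] unfolding b_def by (simp_all add: le_nat_floor B_def)
  have "real (1000 * b ^ 5) \<le> 1000 * (B * L ^ c) ^ 5"
    using power_mono[OF bB, of 5] by simp
  also have "\<dots> \<le> 2 ^ k" using k by (simp add: L_def power_mult_distrib power_mult)
  finally have "1000 * b ^ 5 \<le> 2 ^ k" by (metis of_nat_le_iff of_nat_numeral of_nat_power)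
  then show False
    using no_shallow_formulation[OF form(1) eq_refl[OF form(2)] refl refl] size_bound[OF b] by linarith
qed

theorem theorem1p1: "LOP \<notin> sAvoid_dt \<and> \<not> LOP \<le>\<^sub>d\<^sub>t sAvoid"
  using LOP_not_reducible_sAvoid by (simp add: sAvoid_dt_def)

end
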